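(* Let $f\in\mathcal{F}_{\gamma,\beta}(L)$ with $\gamma, L>0$ and $\beta>2$. Let the noise assumption (with parameter $\sigma\ge 0$) hold and let $Q$ be a convex compact subset of $\mathbb{R}^n$. Let $f$ be $G$-Lipschitz on the Euclidean $\tau_1$-neighborhood of $Q$. Then the optimization error of the averaged estimator $\overline{x}_N=\frac1N\sum_{k=1}^N x_k$, where the points $x_k$ are given by the Zero-order Stochastic Projected Gradient algorithm applied to $f$ with parameters $$\tau_k=\left(\frac{3\kappa\sigma^2 n}{2(\beta-1)(\kappa_\beta L)^2}\right)^{\frac1{2\beta}}k^{-\frac1{2\beta}},\qquad \alpha_k=\frac{2}{\gamma k},\qquad k=1,\dots,N,$$ satisfies $$\mathbb{E}\left[f(\overline{x}_N)-f(x^* )\right]\le\frac1\gamma\left(n^{2-\frac1\beta}\frac{A_1}{N^{\frac{\beta-1}{\beta}}}+A_2\frac{n(1+\ln N)}{N}\right),$$ where $A_1=3\beta(\kappa\sigma^2)^{\frac{\beta-1}{\beta}}(\kappa_\beta L)^{\frac2\beta}$, $A_2=c^*\kappa G^2$, and $\kappa_\beta=\int|u|^\beta|K(u)|\,du$ and $\kappa=\int K^2(u)\,du$ (integrals over $[-1,1]$, $K$ being the kernel used in the algorithm) are constants depending only on $\beta$.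
   Context: Notation: $\|\cdot\|$ and $\langle\cdot,\cdot\rangle$ are the Euclidean norm and standard inner product on $\mathbb{R}^n$; $\Pi_Q$ is the Euclidean projection onto $Q$; $S_n=\{e\in\mathbb{R}^n:\|e\|=1\}$; $U_{\varepsilon_0}(Q)$ is the Euclidean $\varepsilon_0$-neighborhood of $Q$ for a fixed $\varepsilon_0>0$; $x^*$ is a minimizer of $f$ over $Q$. Function classes: let $l$ be the maximal integer strictly less than $\beta$. $\mathcal{F}_\beta(L)$ is the set of functions $f:\mathbb{R}^n\to\mathbb{R}$ which are differentiable $l$ times and satisfy, for all $x,z\in U_{\varepsilon_0}(Q)$, $$\Bigl|f(z)-\sum_{0\le|m|\le l}\frac1{m!}D^mf(x)(z-x)^m\Bigr|\le L\|z-x\|^\beta,$$ where the sum is over multi-indices $m=(m_1,\dots,m_n)$ of nonnegative integers, $m!=m_1!\cdots m_n!$, $|m|=m_1+\dots+m_n$, and $D^mf(x)z^m=\frac{\partial^{|m|}f(x)}{\partial x_1^{m_1}\cdots\partial x_n^{m_n}}z_1^{m_1}\cdots z_n^{m_n}$. $\mathcal{F}_{\gamma,\beta}(L)$ is the set of $\gamma$-strongly convex $f\in\mathcal{F}_\beta(L)$, i.e. $f(z)\ge f(x)+\langle\nabla f(x),z-x\rangle+\frac\gamma2\|x-z\|^2$ for all $x,z\in\mathbb{R}^n$. Kernel: $K:[-1,1]\to\mathbb{R}$ satisfies, with $r$ uniformly distributed on $[-1,1]$, $\mathbb{E}[K(r)]=0$, $\mathbb{E}[rK(r)]=1$, $\mathbb{E}[r^jK(r)]=0$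 for $j=2,\dots,l$, and $\mathbb{E}[|r|^\beta|K(r)|]<\infty$. An example is $K_\beta(r)=\sum_{m=0}^{l}p_m'(0)p_m(r)$ with $p_m=\sqrt{2m+1}\,L_m$, $L_m$ the Legendre polynomials. Algorithm (Zero-order Stochastic Projected Gradient applied to $f$), with kernel $K$, step sizes $\alpha_k>0$ and parameters $\tau_k$: generate scalars $r_1,\dots,r_N$ uniformly on $[-1,1]$ and vectors $e_1,\dots,e_N$ uniformly on $S_n$; starting from $x_1\in Q$, for $k=1,\dots,N$ observe $$y_k=f(x_k+\tau_kr_ke_k)+\xi_k,\qquad y_k'=f(x_k-\tau_kr_ke_k)+\xi_k',$$ set $\widetilde{g_k}=\frac{n}{2\tau_k}(y_k-y_k')e_kK(r_k)$ and update $x_{k+1}=\Pi_Q(x_k-\alpha_k\widetilde{g_k})$. The output is $\{x_k\}_{k=1}^N$. Noise assumption: for all $k=1,\dots,N$, (1) $\mathbb{E}[\xi_k^2]\le\sigma^2$ and $\mathbb{E}[\xi_k'^2]\le\sigma^2$, where $\sigma\ge0$; (2) the random variables $\xi_k$ and $\xi_k'$ are independent from $e_k$ and $r_k$, and the random variables $e_k$ and $r_k$ are independent. Neither zero mean nor i.i.d. of the noise variables is assumed. Constant: $c^*=3c$, where $c<3$ is a positive numerical constant such that for any function $h$ that is $G$-Lipschitz with respect to the Euclidean norm, if $e$ is uniformly distributed on $S_n$ then $\sqrt{\mathbb{E}[(h(e)-\mathbb{E}[h(e)])^4]}\le cG^2/n$.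
   Formalization: Added, since the claim fails or is undefined otherwise: τ_1 ≤ ε_0 (query points stay where f is Hölder); each (e_k, r_k) is independent of all earlier draws and noise together with ξ_k, ξ_k'; and τ_k > 0, which excludes σ = 0 where the algorithm divides by zero. *)

theory Defs
  imports "HOL-Probability.Probability"
begin

definition nbhd :: "'a::metric_space set \<Rightarrow> real \<Rightarrow> 'a set" where
  "nbhd Q \<epsilon> = (\<Union>q\<in>Q. ball q \<epsilon>)"

definition partial_deriv :: "'n::finite \<Rightarrow> (real^'n \<Rightarrow> real) \<Rightarrow> real^'n \<Rightarrow> real" where
  "partial_deriv i f x = deriv (\<lambda>t. f (x + t *\<^sub>R axis i 1)) 0"

definition grad :: "(real^'n::finite \<Rightarrow> real) \<Rightarrow> real^'n \<Rightarrow> real^'n" where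
  "grad f x = (\<chi> i. partial_deriv i f x)"

text \<open>The derivative of \<open>f\<close> is identified with the tuple of its partial derivatives, so that
  \<open>f\<close> is \<open>k + 1\<close> times differentiable iff it is (Frechet) differentiable and all its partial
  derivatives are \<open>k\<close> times differentiable. Continuity of the top derivative is not required.\<close>

primrec times_differentiable :: "nat \<Rightarrow> (real^'n::finite \<Rightarrow> real) \<Rightarrow> bool" where
  "times_differentiable 0 f \<longleftrightarrow> True"
| "times_differentiable (Suc k) f \<longleftrightarrow>
     f differentiable_on UNIV \<and> (\<forall>i. times_differentiable k (partial_deriv i f))"

text \<open>A multi-index is a function \<open>m\<close> on the coordinates. \<open>D\<^sup>m f\<close> takes \<open>m i\<close> partial derivatives
  in each coordinate \<open>i\<close>, in an arbitrary but fixed order; the order is irrelevant for functions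
  that are differentiable \<open>|m|\<close> times, by symmetry of higher derivatives.\<close>

definition multi_deriv :: "('n::finite \<Rightarrow> nat) \<Rightarrow> (real^'n \<Rightarrow> real) \<Rightarrow> real^'n \<Rightarrow> real" where
  "multi_deriv m f = foldr partial_deriv (SOME is. \<forall>i. count_list is i = m i) f"

definition taylor_poly :: "nat \<Rightarrow> (real^'n::finite \<Rightarrow> real) \<Rightarrow> real^'n \<Rightarrow> real^'n \<Rightarrow> real" where
  "taylor_poly l f x z =
     (\<Sum>m\<in>{m :: 'n \<Rightarrow> nat. (\<Sum>i\<in>UNIV. m i) \<le> l}.
        1 / (\<Prod>i\<in>UNIV. fact (m i)) * multi_deriv m f x * (\<Prod>i\<in>UNIV. ((z - x) $ i) ^ m i))"

definition holder_order :: "real \<Rightarrow> nat" where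
  "holder_order \<beta> = (GREATEST l. real l < \<beta>)"

definition holder_class ::
  "(real^'n::finite) set \<Rightarrow> real \<Rightarrow> real \<Rightarrow> real \<Rightarrow> (real^'n \<Rightarrow> real) set" where
  "holder_class Q \<epsilon>0 \<beta> L =
     {f. times_differentiable (holder_order \<beta>) f \<and>
         (\<forall>x\<in>nbhd Q \<epsilon>0. \<forall>z\<in>nbhd Q \<epsilon>0.
            \<bar>f z - taylor_poly (holder_order \<beta>) f x z\<bar> \<le> L * norm (z - x) powr \<beta>)}"

definition strongly_convex_holder_class ::
  "(real^'n::finite) set \<Rightarrow> real \<Rightarrow> real \<Rightarrow> real \<Rightarrow> real \<Rightarrow> (real^'n \<Rightarrow> real) set" where
  "strongly_convex_holder_class Q \<epsilon>0 \<gamma> \<beta> L =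
     {f \<in> holder_class Q \<epsilon>0 \<beta> L.
        \<forall>x z. f z \<ge> f x + grad f x \<bullet> (z - x) + \<gamma> / 2 * (norm (x - z))\<^sup>2}"

abbreviation uniform_interval :: "real measure" where
  "uniform_interval \<equiv> uniform_measure lborel {-1..1}"

text \<open>The uniform distribution on the unit sphere, as the normalised cone measure: the radial
  projection \<open>x \<mapsto> x / \<parallel>x\<parallel>\<close> of the uniform distribution on the unit ball. For the Euclidean norm
  this is the normalised surface measure.\<close>

definition uniform_sphere :: "(real^'n::finite) measure" where
  "uniform_sphere = distr (uniform_measure lborel (ball 0 1)) borel sgn"

text \<open>Integrability is required explicitly because the integral of a non-integrable function
  is 0 by convention. Values of \<open>K\<close> outside \<open>[-1, 1]\<close> play no role (integrability includes Borel
  measurability, so \<open>K\<close> is thought of as extended by 0, say).\<close>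

definition smoothing_kernel :: "real \<Rightarrow> (real \<Rightarrow> real) \<Rightarrow> bool" where
  "smoothing_kernel \<beta> K \<longleftrightarrow>
     integrable uniform_interval K \<and>
     (LINT r|uniform_interval. K r) = 0 \<and>
     (LINT r|uniform_interval. r * K r) = 1 \<and>
     (\<forall>j\<in>{2..holder_order \<beta>}. (LINT r|uniform_interval. r ^ j * K r) = 0) \<and>
     integrable uniform_interval (\<lambda>r. \<bar>r\<bar> powr \<beta> * \<bar>K r\<bar>)"

text \<open>\<open>x k\<close> is the \<open>k\<close>-th iterate along one realisation of the randomisation and the noise; indices
  start at 1.\<close>

definition grad_estimate ::
  "(real^'n::finite \<Rightarrow> real) \<Rightarrow> (real \<Rightarrow> real) \<Rightarrow> real \<Rightarrow> real \<Rightarrow> real^'n \<Rightarrow> real \<Rightarrow> real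
     \<Rightarrow> real^'n \<Rightarrow> real^'n" where
  "grad_estimate f K \<tau> r e \<xi> \<xi>' x =
     (let y = f (x + (\<tau> * r) *\<^sub>R e) + \<xi>;
          y' = f (x - (\<tau> * r) *\<^sub>R e) + \<xi>'
      in (real CARD('n) / (2 * \<tau>) * (y - y') * K r) *\<^sub>R e)"

definition zo_spg ::
  "(real^'n::finite \<Rightarrow> real) \<Rightarrow> (real^'n) set \<Rightarrow> (real \<Rightarrow> real) \<Rightarrow> (nat \<Rightarrow> real) \<Rightarrow> (nat \<Rightarrow> real)
     \<Rightarrow> nat \<Rightarrow> real^'n \<Rightarrow> (nat \<Rightarrow> real) \<Rightarrow> (nat \<Rightarrow> real^'n) \<Rightarrow> (nat \<Rightarrow> real) \<Rightarrow> (nat \<Rightarrow> real)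
     \<Rightarrow> (nat \<Rightarrow> real^'n) \<Rightarrow> bool" where
  "zo_spg f Q K \<alpha> \<tau> N x1 r e \<xi> \<xi>' x \<longleftrightarrow>
     x 1 = x1 \<and>
     (\<forall>k\<in>{1..N}. x (Suc k) =
        closest_point Q (x k - \<alpha> k *\<^sub>R grad_estimate f K (\<tau> k) (r k) (e k) (\<xi> k) (\<xi>' k) (x k)))"

text \<open>The library's \<open>indep_var\<close> forces both variables to have the same value type; this is the same
  notion for two different value types.\<close>

definition indep_rvs ::
  "'w measure \<Rightarrow> 'a measure \<Rightarrow> ('w \<Rightarrow> 'a) \<Rightarrow> 'b measure \<Rightarrow> ('w \<Rightarrow> 'b) \<Rightarrow> bool" where
  "indep_rvs M N1 X N2 Y \<longleftrightarrow>
     X \<in> measurable M N1 \<and> Y \<in> measurable M N2 \<and>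
     prob_space.indep_set M {X -` A \<inter> space M |A. A \<in> sets N1} {Y -` B \<inter> space M |B. B \<in> sets N2}"

text \<open>Neither zero mean nor any independence between different noise variables is assumed.\<close>

definition noise_assumption ::
  "'w measure \<Rightarrow> nat \<Rightarrow> real \<Rightarrow> (nat \<Rightarrow> 'w \<Rightarrow> real) \<Rightarrow> (nat \<Rightarrow> 'w \<Rightarrow> real^'n::finite)
     \<Rightarrow> (nat \<Rightarrow> 'w \<Rightarrow> real) \<Rightarrow> (nat \<Rightarrow> 'w \<Rightarrow> real) \<Rightarrow> bool" where
  "noise_assumption M N \<sigma> r e \<xi> \<xi>' \<longleftrightarrow>
     (\<forall>k\<in>{1..N}.
        \<xi> k \<in> borel_measurable M \<and> \<xi>' k \<in> borel_measurable M \<and>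
        integrable M (\<lambda>\<omega>. (\<xi> k \<omega>)\<^sup>2) \<and> (LINT \<omega>|M. (\<xi> k \<omega>)\<^sup>2) \<le> \<sigma>\<^sup>2 \<and>
        integrable M (\<lambda>\<omega>. (\<xi>' k \<omega>)\<^sup>2) \<and> (LINT \<omega>|M. (\<xi>' k \<omega>)\<^sup>2) \<le> \<sigma>\<^sup>2 \<and>
        indep_rvs M borel (\<lambda>\<omega>. (\<xi> k \<omega>, \<xi>' k \<omega>)) borel (\<lambda>\<omega>. (e k \<omega>, r k \<omega>)) \<and>
        indep_rvs M borel (e k) borel (r k))"

text \<open>The directions and scalars are uniformly distributed and freshly generated: the pair drawn in
  round \<open>k\<close> is independent of everything that happened in the earlier rounds together with the
  noise of round \<open>k\<close>. In particular the draws of different rounds are independent. The noise of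
  round \<open>k\<close> may depend on the past in an arbitrary way.\<close>

definition fresh_uniform_draws ::
  "'w measure \<Rightarrow> nat \<Rightarrow> (nat \<Rightarrow> 'w \<Rightarrow> real) \<Rightarrow> (nat \<Rightarrow> 'w \<Rightarrow> real^'n::finite)
     \<Rightarrow> (nat \<Rightarrow> 'w \<Rightarrow> real) \<Rightarrow> (nat \<Rightarrow> 'w \<Rightarrow> real) \<Rightarrow> bool" where
  "fresh_uniform_draws M N r e \<xi> \<xi>' \<longleftrightarrow>
     (\<forall>k\<in>{1..N}.
        r k \<in> borel_measurable M \<and> distr M borel (r k) = uniform_interval \<and>
        e k \<in> borel_measurable M \<and> distr M borel (e k) = uniform_sphere \<and>
        indep_rvs M
          ((\<Pi>\<^sub>M i\<in>{1..<k}. borel) \<Otimes>\<^sub>M borel)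
          (\<lambda>\<omega>. (\<lambda>i\<in>{1..<k}. (e i \<omega>, r i \<omega>, \<xi> i \<omega>, \<xi>' i \<omega>), (\<xi> k \<omega>, \<xi>' k \<omega>)))
          borel (\<lambda>\<omega>. (e k \<omega>, r k \<omega>)))"

end

theory Submission imports Defs begin

text \<open>The proof follows the squared distance of the iterates to the minimizer. Each step of the
  algorithm moves along a randomised gradient estimate and projects, and projections do not increase
  distances to points of \<open>Q\<close>; so the expected decrease is governed by the bias and the second moment of
  the estimate.

  For both, the current draw of a direction and a scalar is independent of the current iterate and of
  the noise, so it can be integrated out with these held fixed (\<open>indep_rvs_integral\<close>,
  \<open>indep_rvs_integrable_bound\<close>). Since the kernel is orthogonal to all powers of the scalar of degree
  \<open>0\<close> and \<open>2, \<dots>, l\<close>, the Taylor polynomial of \<open>f\<close> contributes exactly its gradient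
  (\<open>integral_kernel_taylor\<close>), the noise averages out, and the Hoelder remainder leaves a bias of order
  \<open>sqrt n * \<tau> powr (\<beta> - 1)\<close> (\<open>grad_estimate_bias\<close>). The factor \<open>sqrt n\<close> instead of \<open>n\<close> is due to a random
  direction being nearly orthogonal to the fixed vector from the minimizer to the iterate
  (\<open>integral_uniform_sphere_abs_inner\<close>). The second moment consists of a term linear in \<open>n\<close>, by
  concentration of Lipschitz functions on the sphere, and a noise term of order \<open>n\<^sup>2 * \<sigma>\<^sup>2 / \<tau>\<^sup>2\<close>
  (\<open>grad_estimate_second_moment\<close>).

  Strong convexity bounds the optimality gap at an iterate by the inner product of the gradient with
  the vector from the minimizer, with a quadratic term to spare. With step sizes \<open>2 / (\<gamma> * k)\<close> the
  resulting recursion for the expected squared distance telescopes (\<open>expected_step\<close>,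
  \<open>telescoped_recursion\<close>), and the sum of the gaps is at most \<open>1 / \<gamma>\<close> times the sum of
  \<open>bias\<^sup>2 + second moment / k\<close>. The radius \<open>\<tau>\<^sub>k\<close> balances the squared bias, of order
  \<open>n * \<tau> powr (2 * \<beta> - 2)\<close>, against the noise term \<open>n\<^sup>2 * \<sigma>\<^sup>2 / (k * \<tau>\<^sup>2)\<close>
  (\<open>balanced_step_cost\<close>); summing over \<open>k\<close> yields the two terms of the rate, the logarithm coming from the
  harmonic sum. Convexity transfers the bound from the mean gap to the gap of the mean
  (\<open>average_gap_le\<close>).\<close>

section \<open>Independence and Fubini\<close>

text \<open>Independence passes to measurable functions of the first variable; this turns independence of the
  whole past into independence of the current iterate.\<close>

lemma indep_rvs_compose:
  assumes M: "prob_space M" and indep: "indep_rvs M N1 X N2 Y"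
    and h: "h \<in> measurable N1 N1'" and X': "\<And>\<omega>. \<omega> \<in> space M \<Longrightarrow> X' \<omega> = h (X \<omega>)"
  shows "indep_rvs M N1' X' N2 Y"
proof -
  interpret prob_space M by fact
  have X: "X \<in> measurable M N1" and Y: "Y \<in> measurable M N2"
    and ind: "indep_set {X -` A \<inter> space M |A. A \<in> sets N1} {Y -` B \<inter> space M |B. B \<in> sets N2}"
    using indep by (auto simp: indep_rvs_def)
  have hX: "(\<lambda>\<omega>. h (X \<omega>)) \<in> measurable M N1'"
    using measurable_compose[OF X h] .
  then have X'm: "X' \<in> measurable M N1'"
    using X' by (simp cong: measurable_cong)
  have pre: "X' -` A \<inter> space M = X -` (h -` A \<inter> space N1) \<inter> space M" for A
    using X' measurable_space[OF X] by auto
  have "indep_set {X' -` A \<inter> space M |A. A \<in> sets N1'} {Y -` B \<inter> space M |B. B \<in> sets N2}"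
  proof (rule indep_setI)
    show "{X' -` A \<inter> space M |A. A \<in> sets N1'} \<subseteq> events" using X'm by auto
    show "{Y -` B \<inter> space M |B. B \<in> sets N2} \<subseteq> events" using Y by auto
    fix a b assume a: "a \<in> {X' -` A \<inter> space M |A. A \<in> sets N1'}"
      and b: "b \<in> {Y -` B \<inter> space M |B. B \<in> sets N2}"
    obtain A where A: "A \<in> sets N1'" "a = X' -` A \<inter> space M" using a by auto
    have "a \<in> {X -` A \<inter> space M |A. A \<in> sets N1}"
      unfolding A(2) pre using measurable_sets[OF h A(1)] by blast
    then show "prob (a \<inter> b) = prob a * prob b" using indep_setD[OF ind _ b] by blast
  qed
  with X'm Y show ?thesis by (simp add: indep_rvs_def)
qed

lemma indep_rvs_distr:
  assumes M: "prob_space M" and indep: "indep_rvs M N1 X N2 Y"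
  shows "distr M (N1 \<Otimes>\<^sub>M N2) (\<lambda>\<omega>. (X \<omega>, Y \<omega>)) = distr M N1 X \<Otimes>\<^sub>M distr M N2 Y"
proof -
  interpret prob_space M by fact
  have X[measurable]: "X \<in> measurable M N1" and Y[measurable]: "Y \<in> measurable M N2"
    and ind: "indep_set {X -` A \<inter> space M |A. A \<in> sets N1} {Y -` B \<inter> space M |B. B \<in> sets N2}"
    using indep by (auto simp: indep_rvs_def)
  interpret X: prob_space "distr M N1 X" by (rule prob_space_distr) fact
  interpret Y: prob_space "distr M N2 Y" by (rule prob_space_distr) fact
  show ?thesis
  proof (rule sym, rule pair_measure_eqI)
    show "sigma_finite_measure (distr M N1 X)" "sigma_finite_measure (distr M N2 Y)"
      by unfold_locales
    show "sets (distr M N1 X \<Otimes>\<^sub>M distr M N2 Y) = sets (distr M (N1 \<Otimes>\<^sub>M N2) (\<lambda>\<omega>. (X \<omega>, Y \<omega>)))"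
      by (simp cong: sets_pair_measure_cong)
    fix A B assume "A \<in> sets (distr M N1 X)" "B \<in> sets (distr M N2 Y)"
    then have A[measurable]: "A \<in> sets N1" and B[measurable]: "B \<in> sets N2" by auto
    have "(\<lambda>\<omega>. (X \<omega>, Y \<omega>)) -` (A \<times> B) \<inter> space M = (X -` A \<inter> space M) \<inter> (Y -` B \<inter> space M)"
      by auto
    moreover have "prob ((X -` A \<inter> space M) \<inter> (Y -` B \<inter> space M))
        = prob (X -` A \<inter> space M) * prob (Y -` B \<inter> space M)"
      using ind A B by (intro indep_setD) auto
    ultimately show "emeasure (distr M N1 X) A * emeasure (distr M N2 Y) B
        = emeasure (distr M (N1 \<Otimes>\<^sub>M N2) (\<lambda>\<omega>. (X \<omega>, Y \<omega>))) (A \<times> B)"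
      by (simp add: emeasure_distr emeasure_eq_measure ennreal_mult[symmetric])
  qed
qed

text \<open>Integrating out \<open>Y\<close> with \<open>X\<close> held fixed replaces the conditional expectation given \<open>X\<close>, so
  that only integrals over the explicit law of \<open>Y\<close> have to be estimated.\<close>

lemma indep_rvs_integral:
  fixes g :: "'a \<times> 'b \<Rightarrow> real"
  assumes M: "prob_space M" and indep: "indep_rvs M N1 X N2 Y"
    and D: "distr M N2 Y = D"
    and g[measurable]: "g \<in> borel_measurable (N1 \<Otimes>\<^sub>M N2)"
    and int: "integrable M (\<lambda>\<omega>. g (X \<omega>, Y \<omega>))"
  shows "integrable M (\<lambda>\<omega>. LINT w|D. g (X \<omega>, w))"
    and "(LINT \<omega>|M. LINT w|D. g (X \<omega>, w)) = (LINT \<omega>|M. g (X \<omega>, Y \<omega>))"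
proof -
  interpret prob_space M by fact
  have X[measurable]: "X \<in> measurable M N1" and Y[measurable]: "Y \<in> measurable M N2"
    using indep by (auto simp: indep_rvs_def)
  interpret X: prob_space "distr M N1 X" by (rule prob_space_distr) fact
  interpret Y: prob_space "distr M N2 Y" by (rule prob_space_distr) fact
  interpret P: pair_sigma_finite "distr M N1 X" "distr M N2 Y" ..
  have setsD[measurable_cong]: "sets D = sets N2" using D by auto
  have int': "integrable (distr M N1 X \<Otimes>\<^sub>M distr M N2 Y) g"
    unfolding indep_rvs_distr[OF M indep, symmetric] using int by (simp add: integrable_distr_eq)
  interpret D: prob_space D using Y.prob_space_axioms by (simp add: D)
  have meas[measurable]: "(\<lambda>x. LINT w|D. g (x, w)) \<in> borel_measurable N1"
    by (rule D.borel_measurable_lebesgue_integral) simp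
  show "integrable M (\<lambda>\<omega>. LINT w|D. g (X \<omega>, w))"
    using P.integrable_fst'[OF int'] by (simp add: D integrable_distr_eq)
  have "(LINT \<omega>|M. LINT w|D. g (X \<omega>, w)) = (LINT x|distr M N1 X. LINT w|D. g (x, w))"
    by (simp add: integral_distr)
  also have "\<dots> = (LINT z|(distr M N1 X \<Otimes>\<^sub>M distr M N2 Y). g z)"
    using P.integral_fst'[OF int'] by (simp add: D)
  also have "\<dots> = (LINT \<omega>|M. g (X \<omega>, Y \<omega>))"
    unfolding indep_rvs_distr[OF M indep, symmetric] by (simp add: integral_distr)
  finally show "(LINT \<omega>|M. LINT w|D. g (X \<omega>, w)) = (LINT \<omega>|M. g (X \<omega>, Y \<omega>))" .
qed

text \<open>The Tonelli counterpart: for nonnegative \<open>g\<close>, integrability is a conclusion. It makes the squared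
  gradient estimate integrable, from which integrability of the linear terms follows.\<close>

lemma indep_rvs_integrable_bound:
  fixes g :: "'a \<times> 'b \<Rightarrow> real"
  assumes M: "prob_space M" and indep: "indep_rvs M N1 X N2 Y"
    and D: "distr M N2 Y = D"
    and g[measurable]: "g \<in> borel_measurable (N1 \<Otimes>\<^sub>M N2)" and nonneg: "\<And>z. 0 \<le> g z"
    and int: "\<And>\<omega>. \<omega> \<in> space M \<Longrightarrow> integrable D (\<lambda>w. g (X \<omega>, w))"
    and le: "\<And>\<omega>. \<omega> \<in> space M \<Longrightarrow> (LINT w|D. g (X \<omega>, w)) \<le> \<phi> \<omega>"
    and \<phi>: "integrable M \<phi>"
  shows "integrable M (\<lambda>\<omega>. g (X \<omega>, Y \<omega>))"
    and "(LINT \<omega>|M. g (X \<omega>, Y \<omega>)) \<le> (LINT \<omega>|M. \<phi> \<omega>)"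
proof -
  interpret prob_space M by fact
  have X[measurable]: "X \<in> measurable M N1" and Y[measurable]: "Y \<in> measurable M N2"
    using indep by (auto simp: indep_rvs_def)
  interpret Y: prob_space "distr M N2 Y" by (rule prob_space_distr) fact
  have setsD[measurable_cong]: "sets D = sets N2" using D by auto
  interpret D: prob_space D using Y.prob_space_axioms by (simp add: D)
  have nn_meas[measurable]: "(\<lambda>x. \<integral>\<^sup>+w. ennreal (g (x, w)) \<partial>D) \<in> borel_measurable N1"
    by (rule D.borel_measurable_nn_integral_fst) simp
  have "(\<integral>\<^sup>+\<omega>. ennreal (g (X \<omega>, Y \<omega>)) \<partial>M)
      = (\<integral>\<^sup>+z. ennreal (g z) \<partial>distr M (N1 \<Otimes>\<^sub>M N2) (\<lambda>\<omega>. (X \<omega>, Y \<omega>)))"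
    by (simp add: nn_integral_distr)
  also have "\<dots> = (\<integral>\<^sup>+x. \<integral>\<^sup>+w. ennreal (g (x, w)) \<partial>D \<partial>distr M N1 X)"
    unfolding indep_rvs_distr[OF M indep] D
    by (subst D.nn_integral_fst) auto
  also have "\<dots> = (\<integral>\<^sup>+\<omega>. \<integral>\<^sup>+w. ennreal (g (X \<omega>, w)) \<partial>D \<partial>M)"
    by (subst nn_integral_distr) auto
  also have "\<dots> = (\<integral>\<^sup>+\<omega>. ennreal (LINT w|D. g (X \<omega>, w)) \<partial>M)"
    using int nonneg by (intro nn_integral_cong nn_integral_eq_integral) auto
  also have "\<dots> \<le> (\<integral>\<^sup>+\<omega>. ennreal (\<phi> \<omega>) \<partial>M)"
    using le by (intro nn_integral_mono ennreal_leI) auto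
  also have "\<dots> = ennreal (LINT \<omega>|M. \<phi> \<omega>)"
  proof (rule nn_integral_eq_integral[OF \<phi>], rule AE_I2)
    fix \<omega> assume "\<omega> \<in> space M"
    have "0 \<le> (LINT w|D. g (X \<omega>, w))" using nonneg by simp
    also have "\<dots> \<le> \<phi> \<omega>" by (rule le) fact
    finally show "0 \<le> \<phi> \<omega>" .
  qed
  finally have fin: "(\<integral>\<^sup>+\<omega>. ennreal (g (X \<omega>, Y \<omega>)) \<partial>M) \<le> ennreal (LINT \<omega>|M. \<phi> \<omega>)" .
  show int: "integrable M (\<lambda>\<omega>. g (X \<omega>, Y \<omega>))"
    using fin nonneg by (intro integrableI_bounded) (auto simp: less_top[symmetric] top_unique)
  have phi0: "0 \<le> (LINT \<omega>|M. \<phi> \<omega>)"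
  proof (rule integral_nonneg_AE, rule AE_I2)
    fix \<omega> assume "\<omega> \<in> space M"
    have "0 \<le> (LINT w|D. g (X \<omega>, w))" using nonneg by simp
    also have "\<dots> \<le> \<phi> \<omega>" by (rule le) fact
    finally show "0 \<le> \<phi> \<omega>" .
  qed
  show "(LINT \<omega>|M. g (X \<omega>, Y \<omega>)) \<le> (LINT \<omega>|M. \<phi> \<omega>)"
    using fin nonneg phi0 by (subst (asm) nn_integral_eq_integral[OF int]) auto
qed

lemma
  fixes a :: "'a \<Rightarrow> real" and b :: "'b \<Rightarrow> real"
  assumes A: "prob_space A" and B: "prob_space B"
    and a: "integrable A a" and b: "integrable B b"
  shows integrable_pair_product: "integrable (A \<Otimes>\<^sub>M B) (\<lambda>z. a (fst z) * b (snd z))"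
    and integral_pair_product:
      "(LINT z|(A \<Otimes>\<^sub>M B). a (fst z) * b (snd z)) = (LINT x|A. a x) * (LINT y|B. b y)"
proof -
  interpret A: prob_space A by fact
  interpret B: prob_space B by fact
  interpret P: pair_sigma_finite A B ..
  have [measurable]: "a \<in> borel_measurable A" "b \<in> borel_measurable B" using a b by auto
  show int: "integrable (A \<Otimes>\<^sub>M B) (\<lambda>z. a (fst z) * b (snd z))"
    using a b by (intro P.Fubini_integrable) (auto simp: abs_mult)
  show "(LINT z|(A \<Otimes>\<^sub>M B). a (fst z) * b (snd z)) = (LINT x|A. a x) * (LINT y|B. b y)"
    using P.integral_fst'[OF int] a b by simp
qed

section \<open>The uniform distribution on the sphere\<close>

lemma emeasure_unit_ball: "emeasure lborel (ball 0 1 :: (real^'n::finite) set) \<noteq> 0"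
  "emeasure lborel (ball 0 1 :: (real^'n::finite) set) < \<infinity>"
proof -
  show "emeasure lborel (ball 0 1 :: (real^'n::finite) set) < \<infinity>"
    by (rule emeasure_lborel_ball_finite)
  show "emeasure lborel (ball 0 1 :: (real^'n::finite) set) \<noteq> 0"
    using open_not_negligible[of "ball 0 1 :: (real^'n) set"]
    by (simp add: negligible_iff_emeasure0)
qed

lemma prob_space_unit_ball:
  "prob_space (uniform_measure lborel (ball 0 1 :: (real^'n::finite) set))"
  using emeasure_unit_ball[where 'n='n] by (intro prob_space_uniform_measure) (auto simp: less_top)

lemma sets_uniform_sphere[simp, measurable_cong]: "sets uniform_sphere = sets borel"
  and space_uniform_sphere[simp]: "space uniform_sphere = UNIV"
  by (simp_all add: uniform_sphere_def)

lemma sgn_measurable_uniform[measurable]: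
  "sgn \<in> borel_measurable (uniform_measure lborel (ball 0 1 :: (real^'n::finite) set))"
  unfolding sgn_div_norm by measurable

lemma prob_space_uniform_sphere: "prob_space (uniform_sphere :: (real^'n::finite) measure)"
  unfolding uniform_sphere_def
  by (rule prob_space.prob_space_distr[OF prob_space_unit_ball]) measurable

lemma AE_uniform_sphere_norm: "AE v in uniform_sphere. norm (v :: real^'n::finite) = 1"
proof -
  have "AE x in lborel. (x :: real^'n) \<noteq> 0"
    by (rule AE_lborel_singleton)
  then have "AE x in uniform_measure lborel (ball 0 1 :: (real^'n) set). norm (sgn x) = 1"
    using emeasure_unit_ball[where 'n='n]
    by (subst AE_uniform_measure) (auto simp: norm_sgn elim: AE_mp)
  then show ?thesis
    unfolding uniform_sphere_def by (subst AE_distr_iff) auto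
qed

text \<open>A linear isometry commutes with the radial projection and maps the unit ball to itself, so the
  sphere inherits every isometric symmetry of Lebesgue measure. Sign flips and permutations of
  coordinates suffice to compute the second moments below.\<close>

lemma distr_uniform_sphere:
  fixes T :: "real^'n::finite \<Rightarrow> real^'n"
  assumes T: "linear T" and norm: "\<And>x. norm (T x) = norm x" and leb: "distr lborel borel T = lborel"
  shows "distr uniform_sphere borel T = uniform_sphere"
proof -
  let ?U = "uniform_measure lborel (ball 0 1 :: (real^'n) set)"
  have [measurable]: "T \<in> borel_measurable borel"
    using T by (simp add: borel_measurable_continuous_onI linear_continuous_on linear_conv_bounded_linear)
  have sgnT: "T (sgn x) = sgn (T x)" for x
    using T norm by (simp add: sgn_div_norm linear_scale)
  have "distr ?U borel T = ?U"
  proof (rule measure_eqI)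
    fix A assume "A \<in> sets (distr ?U borel T)"
    then have A[measurable]: "A \<in> sets borel" by simp
    have "emeasure lborel (ball 0 1 \<inter> A) = emeasure (distr lborel borel T) (ball 0 1 \<inter> A)"
      by (simp add: leb)
    also have "\<dots> = emeasure lborel (T -` (ball 0 1 \<inter> A))"
      by (subst emeasure_distr) auto
    also have "T -` (ball 0 1 \<inter> A) = ball 0 1 \<inter> T -` A"
      using norm by auto
    moreover have "T -` A \<in> sets borel" using measurable_sets[of T borel borel A] by simp
    ultimately show "emeasure (distr ?U borel T) A = emeasure ?U A"
      by (simp add: emeasure_distr)
  qed simp
  then have "distr (distr ?U borel T) borel sgn = uniform_sphere"
    by (simp add: uniform_sphere_def)
  moreover have "distr uniform_sphere borel T = distr ?U borel (\<lambda>x. sgn (T x))"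
    unfolding uniform_sphere_def by (subst distr_distr) (auto simp: o_def sgnT)
  moreover have "distr (distr ?U borel T) borel sgn = distr ?U borel (\<lambda>x. sgn (T x))"
    by (subst distr_distr) (auto simp: o_def sgn_div_norm)
  ultimately show ?thesis by simp
qed

lemma distr_lborel_sign_flip:
  fixes s :: "'n::finite \<Rightarrow> real"
  assumes "\<And>i. \<bar>s i\<bar> = 1"
  shows "distr lborel borel (\<lambda>x. \<chi> i. s i * x $ i) = (lborel :: (real^'n) measure)"
proof -
  \<comment> \<open>The affine transformation rule indexes its scaling factors by basis vectors; the choice
    operator recovers the coordinate of a basis vector.\<close>
  let ?c = "\<lambda>j :: real^'n. s (SOME i. j = axis i 1)"
  have c: "?c (axis i 1) = s i" for i
    by (simp add: axis_eq_axis)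
  have T: "(\<lambda>x. 0 + (\<Sum>j\<in>Basis. (?c j * (x \<bullet> j)) *\<^sub>R j)) = (\<lambda>x. \<chi> i. s i * x $ i :: real^'n)"
  proof
    fix x :: "real^'n"
    show "0 + (\<Sum>j\<in>Basis. (?c j * (x \<bullet> j)) *\<^sub>R j) = (\<chi> i. s i * x $ i)"
      using euclidean_representation[of "\<chi> i. s i * x $ i :: real^'n"]
      by (subst (asm) sum.cong[OF refl, where h="\<lambda>j. (?c j * (x \<bullet> j)) *\<^sub>R j"])
         (auto simp: Basis_vec_def c inner_axis)
  qed
  have abs: "\<bar>?c j\<bar> = 1" for j using assms by simp
  have "lborel = density (distr lborel borel (\<lambda>x. 0 + (\<Sum>j\<in>Basis. (?c j * (x \<bullet> j)) *\<^sub>R j)))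
      (\<lambda>_. (\<Prod>j\<in>(Basis :: (real^'n) set). \<bar>?c j\<bar>))"
    by (rule lborel_affine_euclidean) (use assms in \<open>metis abs_zero zero_neq_one\<close>)
  also have "\<dots> = distr lborel borel (\<lambda>x. \<chi> i. s i * x $ i)"
    unfolding T abs by (simp add: density_1)
  finally show ?thesis by simp
qed

text \<open>The preimage of a box is the box with permuted sides, which has the same volume.\<close>

lemma distr_lborel_permute:
  fixes p :: "'n::finite \<Rightarrow> 'n"
  assumes p: "bij p"
  shows "distr lborel borel (\<lambda>x. \<chi> i. x $ p i) = (lborel :: (real^'n) measure)"
proof (rule sym, rule lborel_eqI)
  let ?T = "\<lambda>x :: real^'n. \<chi> i. x $ p i :: real^'n"
  let ?q = "inv p"
  have pq: "p (?q i) = i" "?q (p i) = i" for i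
    using p by (simp_all add: bij_is_surj surj_f_inv_f bij_is_inj)
  have "continuous_on UNIV ?T" by (intro continuous_intros)
  then have meas[measurable]: "?T \<in> borel_measurable borel" by (rule borel_measurable_continuous_onI)
  fix l u :: "real^'n" assume le: "\<And>b. b \<in> Basis \<Longrightarrow> l \<bullet> b \<le> u \<bullet> b"
  have le': "l $ i \<le> u $ i" for i
    using le[of "axis i 1"] by (simp add: inner_axis axis_in_Basis_iff)
  let ?l = "\<chi> i. l $ ?q i :: real^'n" and ?u = "\<chi> i. u $ ?q i :: real^'n"
  have vim: "?T -` box l u = box ?l ?u"
    using pq by (auto simp: mem_box_cart) metis+
  have prod: "(\<Prod>b\<in>Basis. (y - z) \<bullet> b) = (\<Prod>i\<in>UNIV. y $ i - z $ i)" for y z :: "real^'n"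
  proof -
    have B: "Basis = range (\<lambda>i. axis i 1 :: real^'n)" by (auto simp: Basis_vec_def)
    show ?thesis unfolding B
      by (subst prod.reindex) (auto simp: inj_on_def axis_eq_axis inner_axis)
  qed
  have "emeasure (distr lborel borel ?T) (box l u) = emeasure lborel (box ?l ?u)"
    by (subst emeasure_distr) (auto simp: vim)
  also have "\<dots> = (\<Prod>b\<in>Basis. (?u - ?l) \<bullet> b)"
    using le' by (intro emeasure_lborel_box) (auto simp: Basis_vec_def inner_axis)
  also have "(\<Prod>b\<in>Basis. (?u - ?l) \<bullet> b) = (\<Prod>i\<in>UNIV. u $ ?q i - l $ ?q i)"
    by (simp only: prod) simp
  also have "\<dots> = (\<Prod>i\<in>UNIV. u $ i - l $ i)"
    by (rule prod.reindex_bij_betw) (use bij_imp_bij_inv[OF p] in simp)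
  also have "\<dots> = (\<Prod>b\<in>Basis. (u - l) \<bullet> b)" by (simp only: prod)
  finally show "emeasure (distr lborel borel ?T) (box l u) = (\<Prod>b\<in>Basis. (u - l) \<bullet> b)" .
qed simp

lemma distr_uniform_sphere_sign_flip:
  fixes s :: "'n::finite \<Rightarrow> real"
  assumes "\<And>i. \<bar>s i\<bar> = 1"
  shows "distr uniform_sphere borel (\<lambda>x. \<chi> i. s i * x $ i) = (uniform_sphere :: (real^'n) measure)"
proof (rule distr_uniform_sphere)
  show "linear (\<lambda>x. \<chi> i. s i * x $ i :: real^'n)"
    by (rule linearI) (simp_all add: vec_eq_iff algebra_simps)
  show "norm (\<chi> i. s i * x $ i :: real^'n) = norm x" for x
    by (simp add: norm_vec_def abs_mult assms L2_set_def power_mult_distrib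
        power2_abs[symmetric, of "s _"] del: power2_abs)
qed (rule distr_lborel_sign_flip[OF assms])

lemma distr_uniform_sphere_permute:
  fixes p :: "'n::finite \<Rightarrow> 'n"
  assumes p: "bij p"
  shows "distr uniform_sphere borel (\<lambda>x. \<chi> i. x $ p i) = (uniform_sphere :: (real^'n) measure)"
proof (rule distr_uniform_sphere)
  show "linear (\<lambda>x. \<chi> i. x $ p i :: real^'n)"
    by (rule linearI) (simp_all add: vec_eq_iff)
  show "norm (\<chi> i. x $ p i :: real^'n) = norm x" for x :: "real^'n"
    using sum.reindex_bij_betw[OF p, of "\<lambda>i. (norm (x $ i))\<^sup>2"]
    by (simp add: norm_vec_def L2_set_def)
qed (rule distr_lborel_permute[OF p])

lemma integral_uniform_sphere_uminus:
  fixes h :: "real^'n::finite \<Rightarrow> real"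
  assumes [measurable]: "h \<in> borel_measurable borel"
  shows "(LINT v|uniform_sphere. h (- v)) = (LINT v|uniform_sphere. h v)"
proof -
  have T: "(\<lambda>x :: real^'n. \<chi> i. - 1 * x $ i) = uminus" by (auto simp: vec_eq_iff)
  have *: "distr uniform_sphere borel uminus = (uniform_sphere :: (real^'n) measure)"
    using distr_uniform_sphere_sign_flip[of "\<lambda>_::'n. - 1"] unfolding T by simp
  have "(LINT v|uniform_sphere. h v) = (LINT v|distr uniform_sphere borel uminus. h v)"
    by (simp add: *)
  also have "\<dots> = (LINT v|uniform_sphere. h (- v))"
    by (subst integral_distr) auto
  finally show ?thesis by simp
qed

lemma integrable_uniform_sphere:
  fixes h :: "real^'n::finite \<Rightarrow> real"
  assumes "h \<in> borel_measurable borel" and "\<And>v. norm v = 1 \<Longrightarrow> \<bar>h v\<bar> \<le> B"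
  shows "integrable uniform_sphere h"
proof -
  interpret prob_space "uniform_sphere :: (real^'n) measure" by (rule prob_space_uniform_sphere)
  show ?thesis
    by (rule integrable_const_bound[of _ B]) (use AE_uniform_sphere_norm assms in auto)
qed

text \<open>Flipping the sign of coordinate \<open>i\<close> kills the mixed moments, transpositions make all the squared
  coordinates equal in mean, and the squares sum to \<open>1\<close>.\<close>

lemma integral_uniform_sphere_coords:
  fixes i j :: "'n::finite"
  shows "(LINT v|(uniform_sphere :: (real^'n) measure). v $ i * v $ j)
    = (if i = j then 1 / real CARD('n) else 0)"
proof -
  let ?S = "uniform_sphere :: (real^'n) measure"
  interpret prob_space ?S by (rule prob_space_uniform_sphere)
  have [measurable]: "(\<lambda>v :: real^'n. v $ i) \<in> borel_measurable borel" for i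
    by (intro borel_measurable_continuous_onI continuous_intros)
  have int: "integrable ?S (\<lambda>v. v $ i * v $ j)" for i j
    by (rule integrable_uniform_sphere[of _ 1])
       (simp, metis abs_mult component_le_norm_cart abs_ge_zero mult_le_one real_norm_def)
  show ?thesis
  proof (cases "i = j")
    case False
    let ?s = "\<lambda>k. if k = i then - 1 else 1 :: real"
    let ?T = "\<lambda>x. \<chi> k. ?s k * x $ k :: real^'n"
    have [measurable]: "?T \<in> borel_measurable borel"
      by (intro borel_measurable_continuous_onI continuous_intros)
    have "(LINT v|?S. v $ i * v $ j) = (LINT v|distr ?S borel ?T. v $ i * v $ j)"
      by (subst distr_uniform_sphere_sign_flip) auto
    also have "\<dots> = (LINT v|?S. - (v $ i * v $ j))"
      by (subst integral_distr) (use False in auto)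
    finally show ?thesis using False by simp
  next
    case True
    have same: "(LINT v|?S. v $ k * v $ k) = (LINT v|?S. v $ i * v $ i)" for k
    proof -
      let ?p = "Transposition.transpose i k"
      let ?T = "\<lambda>x. \<chi> j. x $ ?p j :: real^'n"
      have [measurable]: "?T \<in> borel_measurable borel"
        by (intro borel_measurable_continuous_onI continuous_intros)
      have "(LINT v|?S. v $ k * v $ k) = (LINT v|distr ?S borel ?T. v $ k * v $ k)"
        by (subst distr_uniform_sphere_permute) auto
      also have "\<dots> = (LINT v|?S. v $ i * v $ i)"
        by (subst integral_distr) auto
      finally show ?thesis .
    qed
    have "1 = (LINT v|?S. (1::real))" using prob_space by simp
    also have "\<dots> = (LINT v|?S. (\<Sum>k\<in>UNIV. v $ k * v $ k))"
    proof (rule integral_cong_AE)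
      show "AE v in ?S. 1 = (\<Sum>k\<in>UNIV. v $ k * v $ k)"
        using AE_uniform_sphere_norm
      proof eventually_elim
        fix v :: "real^'n" assume "norm v = 1"
        then show "1 = (\<Sum>k\<in>UNIV. v $ k * v $ k)"
          using dot_square_norm[of v] by (simp add: inner_vec_def)
      qed
    qed auto
    also have "\<dots> = (\<Sum>k\<in>(UNIV :: 'n set). LINT v|?S. v $ k * v $ k)"
      by (rule Bochner_Integration.integral_sum) (rule int)
    also have "\<dots> = real CARD('n) * (LINT v|?S. v $ i * v $ i)"
      by (subst sum.cong[OF refl same]) simp
    finally show ?thesis using True by (simp add: field_simps)
  qed
qed

lemma integral_uniform_sphere_inner:
  fixes a b :: "real^'n::finite"
  shows "(LINT v|uniform_sphere. (a \<bullet> v) * (v \<bullet> b)) = (a \<bullet> b) / real CARD('n)"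
proof -
  let ?S = "uniform_sphere :: (real^'n) measure"
  have [measurable]: "(\<lambda>v :: real^'n. v $ i) \<in> borel_measurable borel" for i
    by (intro borel_measurable_continuous_onI continuous_intros)
  have int: "integrable ?S (\<lambda>v. v $ i * v $ j)" for i j
    by (rule integrable_uniform_sphere[of _ 1])
       (simp, metis abs_mult component_le_norm_cart abs_ge_zero mult_le_one real_norm_def)
  have "(LINT v|?S. (a \<bullet> v) * (v \<bullet> b)) = (LINT v|?S. (\<Sum>i\<in>UNIV. \<Sum>j\<in>UNIV. a $ i * b $ j * (v $ i * v $ j)))"
    by (simp add: inner_vec_def sum_product algebra_simps)
  also have "\<dots> = (\<Sum>i\<in>UNIV. \<Sum>j\<in>UNIV. a $ i * b $ j * (LINT v|?S. v $ i * v $ j))"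
    using int by (simp add: Bochner_Integration.integral_sum)
  also have "\<dots> = (a \<bullet> b) / real CARD('n)"
    by (simp add: integral_uniform_sphere_coords inner_vec_def sum_divide_distrib if_distrib sum.delta cong: if_cong)
  finally show ?thesis .
qed

lemma square_integral_le:
  fixes h :: "'a \<Rightarrow> real"
  assumes "prob_space A" and h: "integrable A h" and h2: "integrable A (\<lambda>v. (h v)\<^sup>2)"
  shows "(LINT v|A. h v)\<^sup>2 \<le> (LINT v|A. (h v)\<^sup>2)"
proof -
  interpret prob_space A by fact
  have "0 \<le> variance h" by (rule integral_nonneg_AE) simp
  then show ?thesis using variance_eq[OF h h2] by simp
qed

text \<open>By Cauchy-Schwarz and isotropy, the component of a random direction along a fixed unit vector has
  mean size at most \<open>1 / sqrt n\<close>, whereas a pointwise bound only gives \<open>1\<close>. This gain in the bias is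
  what lowers the dimension exponent of the rate from \<open>2\<close> to \<open>2 - 1 / \<beta>\<close>.\<close>

lemma integral_uniform_sphere_abs_inner:
  fixes u :: "real^'n::finite"
  shows "(LINT v|uniform_sphere. \<bar>v \<bullet> u\<bar>) \<le> norm u / sqrt (real CARD('n))"
proof -
  let ?S = "uniform_sphere :: (real^'n) measure"
  have le: "\<bar>v \<bullet> u\<bar> \<le> norm u" if "norm v = 1" for v
    using Cauchy_Schwarz_ineq2[of v u] that by simp
  have int: "integrable ?S (\<lambda>v. \<bar>v \<bullet> u\<bar>)"
    by (rule integrable_uniform_sphere[of _ "norm u"]) (use le in auto)
  have int2: "integrable ?S (\<lambda>v. \<bar>v \<bullet> u\<bar>\<^sup>2)"
    by (rule integrable_uniform_sphere[of _ "(norm u)\<^sup>2"])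
       (use le in \<open>auto intro!: power_mono simp: abs_le_square_iff[symmetric]\<close>)
  have "(LINT v|?S. \<bar>v \<bullet> u\<bar>)\<^sup>2 \<le> (LINT v|?S. \<bar>v \<bullet> u\<bar>\<^sup>2)"
    by (rule square_integral_le[OF prob_space_uniform_sphere int int2])
  also have "\<dots> = (LINT v|?S. (u \<bullet> v) * (v \<bullet> u))"
    by (simp add: power2_eq_square inner_commute)
  also have "\<dots> = (norm u)\<^sup>2 / real CARD('n)"
    by (simp add: integral_uniform_sphere_inner dot_square_norm)
  finally have "(LINT v|?S. \<bar>v \<bullet> u\<bar>)\<^sup>2 \<le> (norm u / sqrt (real CARD('n)))\<^sup>2"
    by (simp add: power_divide)
  then show ?thesis
    by (rule power2_le_imp_le) simp
qed

section \<open>The uniform distribution on the interval\<close>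

lemma prob_space_uniform_interval: "prob_space uniform_interval"
  by (rule prob_space_uniform_measure) auto

lemma AE_uniform_interval: "AE s in uniform_interval. \<bar>s\<bar> < 1"
proof -
  have "AE s in lborel. s \<noteq> (1::real)" "AE s in lborel. s \<noteq> (- 1::real)"
    by (rule AE_lborel_singleton)+
  then show ?thesis
    by (subst AE_uniform_measure) (auto elim: AE_mp)
qed

lemma
  fixes f :: "real \<Rightarrow> real"
  assumes [measurable]: "f \<in> borel_measurable borel"
  shows integrable_uniform_interval_iff:
      "integrable uniform_interval f \<longleftrightarrow> set_integrable lborel {-1..1} f"
    and integral_uniform_interval:
      "(LINT s|uniform_interval. f s) = (LINT s:{-1..1}|lborel. f s) / 2"
proof -
  have U: "uniform_interval = density lborel (\<lambda>s. ennreal (indicator {-1..1} s / 2))"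
    unfolding uniform_measure_def
    by (rule density_cong)
       (auto split: split_indicator simp: divide_ennreal[symmetric] simp flip: ennreal_numeral ennreal_1)
  have eq: "(\<lambda>s. (indicator {-1..1} s / 2) *\<^sub>R f s) = (\<lambda>s. (1 / 2) * (indicator {-1..1} s *\<^sub>R f s))"
    by auto
  show "integrable uniform_interval f \<longleftrightarrow> set_integrable lborel {-1..1} f"
  proof -
    have "integrable (density lborel (\<lambda>s. ennreal (indicator {-1..1} s / 2))) f
        \<longleftrightarrow> integrable lborel (\<lambda>s. (indicator {-1..1} s / 2) *\<^sub>R f s)"
      by (rule integrable_density) auto
    also have "\<dots> \<longleftrightarrow> integrable lborel (\<lambda>s. indicator {-1..1} s *\<^sub>R f s)"
      unfolding eq by (subst integrable_mult_left_iff) simp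
    finally show ?thesis
      unfolding U set_integrable_def .
  qed
  show "(LINT s|uniform_interval. f s) = (LINT s:{-1..1}|lborel. f s) / 2"
    unfolding U set_lebesgue_integral_def
    by (subst integral_density) (auto simp: eq)
qed

section \<open>Kernel moments\<close>

lemma smoothing_kernel_measurable:
  "smoothing_kernel \<beta> K \<Longrightarrow> K \<in> borel_measurable borel"
  unfolding smoothing_kernel_def
  by (auto dest!: borel_measurable_integrable cong: measurable_cong_sets)

lemma two_le_holder_order:
  assumes "2 < \<beta>"
  shows "2 \<le> holder_order \<beta>"
  unfolding holder_order_def
proof (rule Greatest_le_nat)
  show "real 2 < \<beta>" using assms by simp
  show "y \<le> nat \<lceil>\<beta>\<rceil>" if "real y < \<beta>" for y using that by linarith
qed

lemma smoothing_kernel_moment: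
  assumes K: "smoothing_kernel \<beta> K" and j: "j \<le> holder_order \<beta>"
  shows "integrable uniform_interval (\<lambda>s. s ^ j * K s)"
    and "(LINT s|uniform_interval. s ^ j * K s) = (if j = 1 then 1 else 0)"
proof -
  have [measurable]: "K \<in> borel_measurable borel" by (rule smoothing_kernel_measurable[OF K])
  have "integrable uniform_interval K" using K by (simp add: smoothing_kernel_def)
  then show "integrable uniform_interval (\<lambda>s. s ^ j * K s)"
  proof (rule Bochner_Integration.integrable_bound)
    show "AE s in uniform_interval. norm (s ^ j * K s) \<le> norm (K s)"
      using AE_uniform_interval
      by eventually_elim (simp add: abs_mult power_abs mult_left_le_one_le power_le_one)
  qed simp
  consider "j = 0" | "j = 1" | "j \<in> {2..holder_order \<beta>}" using j by force
  then show "(LINT s|uniform_interval. s ^ j * K s) = (if j = 1 then 1 else 0)"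
    using K by cases (auto simp: smoothing_kernel_def)
qed

section \<open>Taylor polynomials along a ray\<close>

definition taylor_coeff :: "(real^'n::finite \<Rightarrow> real) \<Rightarrow> real^'n \<Rightarrow> ('n \<Rightarrow> nat) \<Rightarrow> real" where
  "taylor_coeff f x m = 1 / (\<Prod>i\<in>UNIV. fact (m i)) * multi_deriv m f x"

lemma taylor_poly_ray:
  "taylor_poly l f x (x + t *\<^sub>R v) = (\<Sum>m\<in>{m. (\<Sum>i\<in>UNIV. m i) \<le> l}.
     taylor_coeff f x m * t ^ (\<Sum>i\<in>UNIV. m i) * (\<Prod>i\<in>UNIV. (v $ i) ^ m i))"
  unfolding taylor_poly_def taylor_coeff_def
  by (intro sum.cong) (simp_all add: power_mult_distrib prod.distrib power_sum)

lemma finite_multi_index: "finite {m :: 'n::finite \<Rightarrow> nat. (\<Sum>i\<in>UNIV. m i) \<le> l}"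
proof (rule finite_subset)
  show "{m :: 'n \<Rightarrow> nat. (\<Sum>i\<in>UNIV. m i) \<le> l} \<subseteq> (UNIV \<rightarrow>\<^sub>E {..l})"
  proof
    fix m :: "'n \<Rightarrow> nat" assume "m \<in> {m. (\<Sum>i\<in>UNIV. m i) \<le> l}"
    then have le: "(\<Sum>i\<in>UNIV. m i) \<le> l" by simp
    have "m i \<le> (\<Sum>i\<in>UNIV. m i)" for i by (rule member_le_sum) auto
    with le show "m \<in> UNIV \<rightarrow>\<^sub>E {..l}" by (auto intro: le_trans)
  qed
qed (simp add: finite_PiE)

text \<open>A list in which \<open>i\<close> occurs once and nothing else occurs is \<open>[i]\<close>, so the arbitrary choice of an
  order of differentiation has only one possible outcome.\<close>

lemma multi_deriv_unit:
  "multi_deriv (\<lambda>j. if j = i then 1 else 0) f = partial_deriv i f"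
proof -
  have uniq: "xs = [i]" if "\<forall>j. count_list xs j = (if j = i then 1 else 0)" for xs
  proof (cases xs)
    case Nil
    with that[rule_format, of i] show ?thesis by simp
  next
    case (Cons a ys)
    have a: "a = i" using that[rule_format, of a] Cons by (auto split: if_splits)
    have "count_list ys j = 0" for j using that[rule_format, of j] Cons a by (auto split: if_splits)
    then have "ys = []" by (metis count_list_0_iff list.set_intros(1) neq_Nil_conv)
    with Cons a show ?thesis by simp
  qed
  have "(SOME is. \<forall>j. count_list is j = (if j = i then 1 else 0)) = [i]"
    by (rule some_equality) (auto intro: uniq)
  then show ?thesis by (simp add: multi_deriv_def)
qed

lemma sum_eq_1_multi_index:
  "{m :: 'n::finite \<Rightarrow> nat. (\<Sum>i\<in>UNIV. m i) = 1} = range (\<lambda>i j. if j = i then 1 else 0)"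
proof (rule set_eqI)
  fix m :: "'n \<Rightarrow> nat"
  have "m \<in> {m. (\<Sum>i\<in>UNIV. m i) = 1} \<longleftrightarrow> (\<exists>i. m i = 1 \<and> (\<forall>j. i \<noteq> j \<longrightarrow> m j = 0))"
    using sum_eq_1_iff[of UNIV m] by auto
  also have "\<dots> \<longleftrightarrow> (\<exists>i. m = (\<lambda>j. if j = i then 1 else 0))"
    by (intro ex_cong1) (force simp: fun_eq_iff)
  also have "\<dots> \<longleftrightarrow> m \<in> range (\<lambda>i j. if j = i then 1 else 0)"
    by (simp only: image_iff bex_UNIV)
  finally show "m \<in> {m. (\<Sum>i\<in>UNIV. m i) = 1} \<longleftrightarrow> m \<in> range (\<lambda>i j. if j = i then 1 else 0)" .
qed

lemma taylor_linear_part: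
  fixes f :: "real^'n::finite \<Rightarrow> real"
  shows "(\<Sum>m | (\<Sum>i\<in>UNIV. m i) = 1. taylor_coeff f x m * (\<Prod>i\<in>UNIV. (v $ i) ^ m i)) = grad f x \<bullet> v"
proof -
  let ?m = "\<lambda>i j :: 'n. if j = i then 1 else 0 :: nat"
  have inj: "inj ?m" by (rule injI) (metis zero_neq_one)
  have prod: "(\<Prod>j\<in>UNIV. (v $ j) ^ ?m i j) = v $ i" for i
    by (simp add: if_distrib[of "\<lambda>k. _ ^ k"] prod.delta cong: if_cong)
  have "(\<Sum>m | (\<Sum>i\<in>UNIV. m i) = 1. taylor_coeff f x m * (\<Prod>i\<in>UNIV. (v $ i) ^ m i))
      = (\<Sum>i\<in>UNIV. taylor_coeff f x (?m i) * (\<Prod>j\<in>UNIV. (v $ j) ^ ?m i j))"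
    unfolding sum_eq_1_multi_index by (subst sum.reindex[OF inj]) simp
  also have "\<dots> = (\<Sum>i\<in>UNIV. partial_deriv i f x * v $ i)"
    unfolding prod taylor_coeff_def multi_deriv_unit
    by (intro sum.cong refl) (simp add: if_distrib[of fact] cong: if_cong)
  also have "\<dots> = grad f x \<bullet> v"
    by (simp add: inner_vec_def grad_def)
  finally show ?thesis .
qed

section \<open>The law of one draw\<close>

abbreviation draw_law :: "((real^'n::finite) \<times> real) measure" where
  "draw_law \<equiv> uniform_sphere \<Otimes>\<^sub>M uniform_interval"

lemma sets_draw_law: "sets (draw_law :: ((real^'n::finite) \<times> real) measure) = sets borel"
  by (simp add: borel_prod[symmetric] cong: sets_pair_measure_cong)

lemma pair_prob_space_draw_law:
  "pair_prob_space (uniform_sphere :: (real^'n::finite) measure) uniform_interval"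
proof -
  interpret S: prob_space "uniform_sphere :: (real^'n) measure" by (rule prob_space_uniform_sphere)
  interpret U: prob_space uniform_interval by (rule prob_space_uniform_interval)
  show ?thesis ..
qed

lemma AE_draw_law:
  "AE w in (draw_law :: ((real^'n::finite) \<times> real) measure). norm (fst w) = 1 \<and> \<bar>snd w\<bar> < 1"
proof -
  interpret P: pair_prob_space "uniform_sphere :: (real^'n) measure" uniform_interval
    by (rule pair_prob_space_draw_law)
  show ?thesis
  proof (rule P.AE_pair_measure)
    show "AE v in (uniform_sphere :: (real^'n) measure). AE s in uniform_interval.
        norm (fst (v, s)) = 1 \<and> \<bar>snd (v, s)\<bar> < 1"
      using AE_uniform_sphere_norm
    proof eventually_elim
      fix v :: "real^'n" assume "norm v = 1"
      then show "AE s in uniform_interval. norm (fst (v, s)) = 1 \<and> \<bar>snd (v, s)\<bar> < 1"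
        using AE_uniform_interval by simp
    qed
  qed measurable
qed

lemma integrable_draw_law_bound:
  fixes h :: "(real^'n::finite) \<times> real \<Rightarrow> real" and b :: "real \<Rightarrow> real"
  assumes h: "h \<in> borel_measurable borel" and b: "integrable uniform_interval b"
    and le: "\<And>v s. norm v = 1 \<Longrightarrow> \<bar>s\<bar> < 1 \<Longrightarrow> \<bar>h (v, s)\<bar> \<le> C * \<bar>b s\<bar>"
  shows "integrable draw_law h"
proof -
  let ?S = "uniform_sphere :: (real^'n) measure"
  interpret S: prob_space ?S by (rule prob_space_uniform_sphere)
  have "integrable (?S \<Otimes>\<^sub>M uniform_interval) (\<lambda>w. C * \<bar>b (snd w)\<bar>)"
    using integrable_pair_product[OF prob_space_uniform_sphere prob_space_uniform_interval,
      of "\<lambda>_::real^'n. C" "\<lambda>s. \<bar>b s\<bar>"] b by simp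
  then show ?thesis
  proof (rule Bochner_Integration.integrable_bound)
    show "h \<in> borel_measurable (?S \<Otimes>\<^sub>M uniform_interval)"
      using h measurable_cong_sets[OF sets_draw_law refl] by blast
    show "AE w in ?S \<Otimes>\<^sub>M uniform_interval. norm (h w) \<le> norm (C * \<bar>b (snd w)\<bar>)"
      using AE_draw_law
    proof eventually_elim
      fix w :: "(real^'n) \<times> real" assume w: "norm (fst w) = 1 \<and> \<bar>snd w\<bar> < 1"
      then have "\<bar>h w\<bar> \<le> C * \<bar>b (snd w)\<bar>" using le[of "fst w" "snd w"] by simp
      then show "norm (h w) \<le> norm (C * \<bar>b (snd w)\<bar>)" by simp
    qed
  qed
qed

text \<open>Along a ray the Taylor polynomial is a polynomial in the scalar \<open>s\<close>. The kernel annihilates its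
  terms of degree \<open>0\<close> and \<open>2, \<dots>, l\<close> and has first moment \<open>1\<close>, so only the linear part survives;
  isotropy of the direction then turns \<open>(grad f x \<bullet> v) * (v \<bullet> u)\<close> into \<open>grad f x \<bullet> u\<close> up to the factor
  \<open>1 / n\<close>.\<close>

lemma integral_kernel_taylor:
  fixes f :: "real^'n::finite \<Rightarrow> real" and x u :: "real^'n" and t :: real
  assumes K: "smoothing_kernel \<beta> K" and \<beta>: "2 < \<beta>"
  defines "T \<equiv> \<lambda>t w. taylor_poly (holder_order \<beta>) f x (x + (t * snd w) *\<^sub>R fst w)"
  shows "integrable draw_law (\<lambda>w. K (snd w) * T t w * (fst w \<bullet> u))"
    and "(LINT w|draw_law. K (snd w) * T t w * (fst w \<bullet> u)) = t * (grad f x \<bullet> u) / real CARD('n)"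
proof -
  let ?S = "uniform_sphere :: (real^'n) measure"
  let ?l = "holder_order \<beta>"
  let ?I = "{m :: 'n \<Rightarrow> nat. (\<Sum>i\<in>UNIV. m i) \<le> ?l}"
  let ?deg = "\<lambda>m :: 'n \<Rightarrow> nat. \<Sum>i\<in>UNIV. m i"
  let ?a = "\<lambda>m v. (\<Prod>i\<in>UNIV. (v $ i) ^ m i) * (v \<bullet> u)"
  let ?term = "\<lambda>m w. taylor_coeff f x m * t ^ ?deg m * (?a m (fst w) * (snd w ^ ?deg m * K (snd w)))"
  interpret S: prob_space ?S by (rule prob_space_uniform_sphere)
  have expand: "K (snd w) * T t w * (fst w \<bullet> u) = (\<Sum>m\<in>?I. ?term m w)" for w
    unfolding T_def taylor_poly_ray sum_distrib_left sum_distrib_right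
    by (intro sum.cong refl) (simp add: power_mult_distrib algebra_simps)
  have a_meas: "?a m \<in> borel_measurable borel" for m
    by (intro borel_measurable_continuous_onI continuous_intros)
  have a_int: "integrable ?S (?a m)" for m
  proof (rule integrable_uniform_sphere[OF a_meas])
    fix v :: "real^'n" assume v: "norm v = 1"
    have "\<bar>\<Prod>i\<in>UNIV. (v $ i) ^ m i\<bar> \<le> 1"
      unfolding abs_prod using component_le_norm_cart[of v] v
      by (intro prod_le_1) (auto simp: power_abs intro!: power_le_one)
    moreover have "\<bar>v \<bullet> u\<bar> \<le> norm u" using Cauchy_Schwarz_ineq2[of v u] v by simp
    ultimately show "\<bar>?a m v\<bar> \<le> 1 * norm u"
      unfolding abs_mult by (intro mult_mono) auto
  qed
  have term_int: "integrable draw_law (?term m)" if "m \<in> ?I" for m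
    using integrable_pair_product[OF prob_space_uniform_sphere prob_space_uniform_interval a_int
      smoothing_kernel_moment(1)[OF K], of "?deg m" m] that by (intro integrable_mult_right) simp
  have term_eq: "(LINT w|draw_law. ?term m w)
      = (if ?deg m = 1 then t * (taylor_coeff f x m * (LINT v|?S. ?a m v)) else 0)" if "m \<in> ?I" for m
  proof -
    have "(LINT w|draw_law. ?term m w) = taylor_coeff f x m * t ^ ?deg m *
        (LINT w|draw_law. ?a m (fst w) * (snd w ^ ?deg m * K (snd w)))"
      by (rule integral_mult_right_zero)
    also have "(LINT w|draw_law. ?a m (fst w) * (snd w ^ ?deg m * K (snd w)))
        = (LINT v|?S. ?a m v) * (LINT s|uniform_interval. s ^ ?deg m * K s)"
      by (rule integral_pair_product[OF prob_space_uniform_sphere prob_space_uniform_interval a_int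
        smoothing_kernel_moment(1)[OF K]]) (use that in simp)
    also have "(LINT s|uniform_interval. s ^ ?deg m * K s) = (if ?deg m = 1 then 1 else 0)"
      by (rule smoothing_kernel_moment(2)[OF K]) (use that in simp)
    finally show ?thesis by (simp split: if_splits)
  qed
  show "integrable draw_law (\<lambda>w. K (snd w) * T t w * (fst w \<bullet> u))"
    unfolding expand by (rule Bochner_Integration.integrable_sum) (rule term_int)
  have "(LINT w|draw_law. K (snd w) * T t w * (fst w \<bullet> u)) = (\<Sum>m\<in>?I. LINT w|draw_law. ?term m w)"
    unfolding expand by (rule Bochner_Integration.integral_sum) (rule term_int)
  also have "\<dots> = (\<Sum>m\<in>?I. if ?deg m = 1 then t * (taylor_coeff f x m * (LINT v|?S. ?a m v)) else 0)"
    by (rule sum.cong[OF refl]) (rule term_eq)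
  also have "\<dots> = (\<Sum>m\<in>?I \<inter> {m. ?deg m = 1}. t * (taylor_coeff f x m * (LINT v|?S. ?a m v)))"
    by (rule sum.inter_restrict[OF finite_multi_index, symmetric, THEN trans[rotated]]) (simp cong: if_cong)
  also have "?I \<inter> {m. ?deg m = 1} = {m. ?deg m = 1}"
    using two_le_holder_order[OF \<beta>] by auto
  also have "(\<Sum>m | ?deg m = 1. t * (taylor_coeff f x m * (LINT v|?S. ?a m v)))
      = t * (LINT v|?S. (\<Sum>m | ?deg m = 1. taylor_coeff f x m * ?a m v))"
    using a_int by (simp add: sum_distrib_left Bochner_Integration.integral_sum)
  also have "(\<lambda>v. \<Sum>m | ?deg m = 1. taylor_coeff f x m * ?a m v) = (\<lambda>v. (grad f x \<bullet> v) * (v \<bullet> u))"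
    unfolding taylor_linear_part[symmetric] sum_distrib_right by (simp add: algebra_simps)
  finally show "(LINT w|draw_law. K (snd w) * T t w * (fst w \<bullet> u)) = t * (grad f x \<bullet> u) / real CARD('n)"
    by (simp add: integral_uniform_sphere_inner)
qed

section \<open>Bias and second moment of the gradient estimate\<close>

lemma inner_grad_estimate:
  fixes x u :: "real^'n::finite"
  shows "grad_estimate f K \<tau> s v a b x \<bullet> u = real CARD('n) / (2 * \<tau>) *
    (K s * f (x + (\<tau> * s) *\<^sub>R v) * (v \<bullet> u) - K s * f (x + (- \<tau> * s) *\<^sub>R v) * (v \<bullet> u)
      + (a - b) * ((v \<bullet> u) * K s))"
proof -
  have "grad_estimate f K \<tau> s v a b x \<bullet> u = (real CARD('n) / (2 * \<tau>) *
      (f (x + (\<tau> * s) *\<^sub>R v) + a - (f (x - (\<tau> * s) *\<^sub>R v) + b)) * K s) * (v \<bullet> u)"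
    by (simp add: grad_estimate_def Let_def)
  also have "x - (\<tau> * s) *\<^sub>R v = x + (- \<tau> * s) *\<^sub>R v" by simp
  finally show ?thesis by algebra
qed

text \<open>Expectations under the uniform distribution are half of the integrals over \<open>[-1, 1]\<close> in terms of
  which the kernel constants are defined.\<close>

lemma kernel_uniform_moments:
  assumes K: "smoothing_kernel \<beta> K"
  shows "(LINT s|uniform_interval. \<bar>s\<bar> powr \<beta> * \<bar>K s\<bar>) = (LINT s:{-1..1}|lborel. \<bar>s\<bar> powr \<beta> * \<bar>K s\<bar>) / 2"
    and "set_integrable lborel {-1..1} (\<lambda>s. (K s)\<^sup>2) \<Longrightarrow> integrable uniform_interval (\<lambda>s. (K s)\<^sup>2)"
    and "(LINT s|uniform_interval. (K s)\<^sup>2) = (LINT s:{-1..1}|lborel. (K s)\<^sup>2) / 2"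
proof -
  have [measurable]: "K \<in> borel_measurable borel" by (rule smoothing_kernel_measurable[OF K])
  show "(LINT s|uniform_interval. \<bar>s\<bar> powr \<beta> * \<bar>K s\<bar>) = (LINT s:{-1..1}|lborel. \<bar>s\<bar> powr \<beta> * \<bar>K s\<bar>) / 2"
    by (rule integral_uniform_interval) simp
  show "(LINT s|uniform_interval. (K s)\<^sup>2) = (LINT s:{-1..1}|lborel. (K s)\<^sup>2) / 2"
    by (rule integral_uniform_interval) simp
  show "set_integrable lborel {-1..1} (\<lambda>s. (K s)\<^sup>2) \<Longrightarrow> integrable uniform_interval (\<lambda>s. (K s)\<^sup>2)"
    by (subst integrable_uniform_interval_iff) auto
qed

lemma bounded_on_cball:
  fixes f :: "real^'n::finite \<Rightarrow> real"
  assumes "continuous_on UNIV f"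
  obtains B where "\<And>y. y \<in> cball x \<rho> \<Longrightarrow> \<bar>f y\<bar> \<le> B"
proof -
  have "compact (f ` cball x \<rho>)"
    by (intro compact_continuous_image continuous_on_subset[OF assms]) auto
  then obtain B where "\<forall>z\<in>f ` cball x \<rho>. norm z \<le> B"
    using compact_imp_bounded bounded_iff by metis
  then show thesis using that[of B] by auto
qed

lemma sample_point_measurable:
  fixes f :: "real^'n::finite \<Rightarrow> real" and x u :: "real^'n"
  assumes f: "continuous_on UNIV f" and K: "K \<in> borel_measurable borel"
  shows "(\<lambda>w. K (snd w) * f (x + (t * snd w) *\<^sub>R fst w) * (fst w \<bullet> u)) \<in> borel_measurable borel"
proof -
  have [measurable]: "f \<in> borel_measurable borel" by (rule borel_measurable_continuous_onI[OF f])
  have [measurable]: "K \<in> borel_measurable borel" by (rule K)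
  show ?thesis unfolding borel_prod[symmetric] by measurable
qed

lemma abs_inner_le_of_unit:
  "norm v = 1 \<Longrightarrow> \<bar>v \<bullet> u\<bar> \<le> norm u"
  using Cauchy_Schwarz_ineq2[of v u] by simp

text \<open>Replacing \<open>f\<close> by its Taylor polynomial costs at most \<open>L * \<bar>t * s\<bar> powr \<beta>\<close> at the sample point, and the
  direction contributes \<open>\<bar>v \<bullet> u\<bar>\<close> independently of the scalar. Keeping this factor, instead of bounding it
  by \<open>norm u\<close>, is what produces \<open>sqrt n\<close> rather than \<open>n\<close> in the bias.\<close>

lemma kernel_remainder:
  fixes f :: "real^'n::finite \<Rightarrow> real" and x u :: "real^'n"
  assumes cont: "continuous_on UNIV f" and f: "f \<in> holder_class Q \<epsilon>0 \<beta> L" and L: "0 \<le> L"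
    and K: "smoothing_kernel \<beta> K" and \<beta>: "2 < \<beta>"
    and x: "x \<in> Q" and t: "\<bar>t\<bar> \<le> \<epsilon>0" "0 < \<epsilon>0"
  defines "\<kappa>\<beta> \<equiv> (LINT s:{-1..1}|lborel. \<bar>s\<bar> powr \<beta> * \<bar>K s\<bar>)"
  shows "integrable draw_law (\<lambda>w. K (snd w) * f (x + (t * snd w) *\<^sub>R fst w) * (fst w \<bullet> u))"
    and "\<bar>(LINT w|draw_law. K (snd w) * f (x + (t * snd w) *\<^sub>R fst w) * (fst w \<bullet> u))
        - t * (grad f x \<bullet> u) / real CARD('n)\<bar>
      \<le> L * \<bar>t\<bar> powr \<beta> * (\<kappa>\<beta> / 2) * (norm u / sqrt (real CARD('n)))"
proof -
  let ?S = "uniform_sphere :: (real^'n) measure"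
  let ?F = "\<lambda>w. K (snd w) * f (x + (t * snd w) *\<^sub>R fst w) * (fst w \<bullet> u)"
  let ?T = "\<lambda>w. K (snd w) * taylor_poly (holder_order \<beta>) f x (x + (t * snd w) *\<^sub>R fst w) * (fst w \<bullet> u)"
  let ?b = "\<lambda>w. L * \<bar>t\<bar> powr \<beta> * (\<bar>fst w \<bullet> u\<bar> * (\<bar>snd w\<bar> powr \<beta> * \<bar>K (snd w)\<bar>))"
  have Km: "K \<in> borel_measurable borel" by (rule smoothing_kernel_measurable[OF K])
  have Kint: "integrable uniform_interval K" using K by (simp add: smoothing_kernel_def)
  obtain B where B: "\<And>y. y \<in> cball x \<bar>t\<bar> \<Longrightarrow> \<bar>f y\<bar> \<le> B" using bounded_on_cball[OF cont] by blast
  show F: "integrable draw_law ?F"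
  proof (rule integrable_draw_law_bound[OF _ Kint])
    fix v :: "real^'n" and s :: real assume v: "norm v = 1" and s: "\<bar>s\<bar> < 1"
    have "\<bar>t * s\<bar> \<le> \<bar>t\<bar>" using s by (simp add: abs_mult mult_left_le)
    then have "\<bar>f (x + (t * s) *\<^sub>R v)\<bar> \<le> B" using v by (intro B) (simp add: dist_norm)
    moreover have "\<bar>v \<bullet> u\<bar> \<le> norm u" using Cauchy_Schwarz_ineq2[of v u] v by simp
    ultimately have "\<bar>K s\<bar> * \<bar>f (x + (t * s) *\<^sub>R v)\<bar> * \<bar>v \<bullet> u\<bar> \<le> \<bar>K s\<bar> * B * norm u"
      by (intro mult_mono mult_nonneg_nonneg) auto
    then show "\<bar>K (snd (v, s)) * f (x + (t * snd (v, s)) *\<^sub>R fst (v, s)) * (fst (v, s) \<bullet> u)\<bar>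
        \<le> B * norm u * \<bar>K s\<bar>"
      by (simp add: abs_mult algebra_simps)
  qed (rule sample_point_measurable[OF cont Km])
  note T = integral_kernel_taylor[OF K \<beta>, of f x t u]
  have absu: "integrable ?S (\<lambda>v. \<bar>v \<bullet> u\<bar>)"
    by (rule integrable_uniform_sphere[of _ "norm u"]) (auto intro: abs_inner_le_of_unit)
  have b: "integrable draw_law ?b"
    and b_eq: "(LINT w|draw_law. ?b w)
      = L * \<bar>t\<bar> powr \<beta> * ((LINT v|?S. \<bar>v \<bullet> u\<bar>) * (LINT s|uniform_interval. \<bar>s\<bar> powr \<beta> * \<bar>K s\<bar>))"
  proof -
    have k: "integrable uniform_interval (\<lambda>s. \<bar>s\<bar> powr \<beta> * \<bar>K s\<bar>)"
      using K by (simp add: smoothing_kernel_def)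
    show "integrable draw_law ?b"
      by (intro integrable_mult_right
        integrable_pair_product[OF prob_space_uniform_sphere prob_space_uniform_interval absu k])
    show "(LINT w|draw_law. ?b w)
      = L * \<bar>t\<bar> powr \<beta> * ((LINT v|?S. \<bar>v \<bullet> u\<bar>) * (LINT s|uniform_interval. \<bar>s\<bar> powr \<beta> * \<bar>K s\<bar>))"
      unfolding integral_mult_right_zero
        integral_pair_product[OF prob_space_uniform_sphere prob_space_uniform_interval absu k] ..
  qed
  have "\<bar>(LINT w|draw_law. ?F w) - (LINT w|draw_law. ?T w)\<bar> = \<bar>LINT w|draw_law. ?F w - ?T w\<bar>"
    using F T(1) by simp
  also have "\<dots> \<le> (LINT w|draw_law. \<bar>?F w - ?T w\<bar>)"
    by (rule integral_abs_bound)
  also have "\<dots> \<le> (LINT w|draw_law. ?b w)"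
  proof (rule integral_mono_AE)
    show "AE w in draw_law. \<bar>?F w - ?T w\<bar> \<le> ?b w"
      using AE_draw_law
    proof eventually_elim
      fix w :: "(real^'n) \<times> real" assume w: "norm (fst w) = 1 \<and> \<bar>snd w\<bar> < 1"
      let ?z = "x + (t * snd w) *\<^sub>R fst w"
      have lt: "norm ((t * snd w) *\<^sub>R fst w) < \<epsilon>0"
      proof (cases "t = 0")
        case False
        then have "\<bar>t\<bar> * \<bar>snd w\<bar> < \<bar>t\<bar>" using w by simp
        then show ?thesis using w t by (simp add: abs_mult)
      qed (use t in simp)
      have "x \<in> nbhd Q \<epsilon>0" "?z \<in> nbhd Q \<epsilon>0"
        using x t lt by (auto simp: nbhd_def dist_norm intro!: bexI[of _ x])
      then have "\<bar>f ?z - taylor_poly (holder_order \<beta>) f x ?z\<bar> \<le> L * norm (?z - x) powr \<beta>"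
        using f unfolding holder_class_def by blast
      also have "norm (?z - x) = \<bar>t\<bar> * \<bar>snd w\<bar>" using w by (simp add: abs_mult)
      also have "L * (\<bar>t\<bar> * \<bar>snd w\<bar>) powr \<beta> = L * \<bar>t\<bar> powr \<beta> * \<bar>snd w\<bar> powr \<beta>"
        by (simp add: powr_mult)
      finally have "\<bar>K (snd w)\<bar> * \<bar>f ?z - taylor_poly (holder_order \<beta>) f x ?z\<bar> * \<bar>fst w \<bullet> u\<bar>
          \<le> \<bar>K (snd w)\<bar> * (L * \<bar>t\<bar> powr \<beta> * \<bar>snd w\<bar> powr \<beta>) * \<bar>fst w \<bullet> u\<bar>"
        by (intro mult_right_mono mult_left_mono) auto
      then show "\<bar>?F w - ?T w\<bar> \<le> ?b w"
        by (simp add: abs_mult[symmetric] algebra_simps)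
    qed
  qed (use F T(1) b in auto)
  also have "\<dots> \<le> L * \<bar>t\<bar> powr \<beta> * ((norm u / sqrt (real CARD('n))) * (\<kappa>\<beta> / 2))"
    unfolding b_eq kernel_uniform_moments(1)[OF K] \<kappa>\<beta>_def
    using L integral_uniform_sphere_abs_inner[of u]
    by (intro mult_left_mono mult_right_mono)
       (auto simp: set_lebesgue_integral_def intro!: Bochner_Integration.integral_nonneg)
  finally show "\<bar>(LINT w|draw_law. ?F w) - t * (grad f x \<bullet> u) / real CARD('n)\<bar>
      \<le> L * \<bar>t\<bar> powr \<beta> * (\<kappa>\<beta> / 2) * (norm u / sqrt (real CARD('n)))"
    unfolding T(2) by (simp add: algebra_simps)
qed

text \<open>Applying \<open>kernel_remainder\<close> to both sample points, the linear parts add up and the errors are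
  bounded separately. The noise values \<open>a\<close> and \<open>b\<close> are constants here, because the draw is independent
  of them, and they drop out since the kernel has mean \<open>0\<close>; hence noise of nonzero mean causes no bias.\<close>

lemma grad_estimate_bias:
  fixes f :: "real^'n::finite \<Rightarrow> real" and x u :: "real^'n"
  assumes cont: "continuous_on UNIV f" and f: "f \<in> holder_class Q \<epsilon>0 \<beta> L" and L: "0 \<le> L"
    and K: "smoothing_kernel \<beta> K" and \<beta>: "2 < \<beta>"
    and x: "x \<in> Q" and \<tau>: "0 < \<tau>" "\<tau> \<le> \<epsilon>0"
  defines "\<kappa>\<beta> \<equiv> (LINT s:{-1..1}|lborel. \<bar>s\<bar> powr \<beta> * \<bar>K s\<bar>)"
  shows "\<bar>(LINT w|draw_law. grad_estimate f K \<tau> (snd w) (fst w) a b x \<bullet> u) - grad f x \<bullet> u\<bar>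
      \<le> \<kappa>\<beta> / 2 * L * sqrt (real CARD('n)) * \<tau> powr (\<beta> - 1) * norm u"
proof -
  let ?S = "uniform_sphere :: (real^'n) measure"
  let ?n = "real CARD('n)"
  let ?F = "\<lambda>t w. K (snd w) * f (x + (t * snd w) *\<^sub>R fst w) * (fst w \<bullet> u)"
  let ?E = "L * \<tau> powr \<beta> * (\<kappa>\<beta> / 2) * (norm u / sqrt ?n)"
  have n: "0 < ?n" by simp
  have \<epsilon>0: "0 < \<epsilon>0" using \<tau> by linarith
  note rem = kernel_remainder[OF cont f L K \<beta> x _ \<epsilon>0, of _ u, folded \<kappa>\<beta>_def]
  have Fp: "integrable draw_law (?F \<tau>)" and Fm: "integrable draw_law (?F (- \<tau>))"
    using rem(1)[of \<tau>] rem(1)[of "- \<tau>"] \<tau> by simp_all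
  have Kint: "integrable uniform_interval K" and K0: "(LINT s|uniform_interval. K s) = 0"
    using K by (auto simp: smoothing_kernel_def)
  have vu: "integrable ?S (\<lambda>v. v \<bullet> u)"
    by (rule integrable_uniform_sphere[of _ "norm u"]) (auto intro: abs_inner_le_of_unit)
  note P = integrable_pair_product[OF prob_space_uniform_sphere prob_space_uniform_interval vu Kint]
    integral_pair_product[OF prob_space_uniform_sphere prob_space_uniform_interval vu Kint]
  have "(LINT w|draw_law. grad_estimate f K \<tau> (snd w) (fst w) a b x \<bullet> u)
      = ?n / (2 * \<tau>) * (LINT w|draw_law. ?F \<tau> w - ?F (- \<tau>) w + (a - b) * ((fst w \<bullet> u) * K (snd w)))"
    unfolding inner_grad_estimate by (rule integral_mult_right_zero)
  also have "(LINT w|draw_law. ?F \<tau> w - ?F (- \<tau>) w + (a - b) * ((fst w \<bullet> u) * K (snd w)))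
      = (LINT w|draw_law. ?F \<tau> w) - (LINT w|draw_law. ?F (- \<tau>) w)
        + (a - b) * (LINT w|draw_law. (fst w \<bullet> u) * K (snd w))"
    using Fp Fm P(1) by (simp del: mult_minus_left)
  also have "(LINT w|draw_law. (fst w \<bullet> u) * K (snd w)) = 0" by (simp add: P(2) K0)
  finally have eq: "(LINT w|draw_law. grad_estimate f K \<tau> (snd w) (fst w) a b x \<bullet> u)
      = ?n / (2 * \<tau>) * ((LINT w|draw_law. ?F \<tau> w) - (LINT w|draw_law. ?F (- \<tau>) w))" by simp
  have "\<bar>(LINT w|draw_law. ?F \<tau> w) - \<tau> * (grad f x \<bullet> u) / ?n\<bar> \<le> ?E"
    using rem(2)[of \<tau>] \<tau> by simp
  moreover have "\<bar>(LINT w|draw_law. ?F (- \<tau>) w) - (- \<tau>) * (grad f x \<bullet> u) / ?n\<bar> \<le> ?E"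
    using rem(2)[of "- \<tau>"] \<tau> by simp
  ultimately have "\<bar>((LINT w|draw_law. ?F \<tau> w) - (LINT w|draw_law. ?F (- \<tau>) w))
      - 2 * \<tau> / ?n * (grad f x \<bullet> u)\<bar> \<le> 2 * ?E"
    unfolding abs_le_iff by (simp add: algebra_simps)
  then have "?n / (2 * \<tau>) * \<bar>((LINT w|draw_law. ?F \<tau> w) - (LINT w|draw_law. ?F (- \<tau>) w))
      - 2 * \<tau> / ?n * (grad f x \<bullet> u)\<bar> \<le> ?n / (2 * \<tau>) * (2 * ?E)"
    using \<tau> by (intro mult_left_mono) auto
  also have "?n / (2 * \<tau>) * (2 * ?E) = \<kappa>\<beta> / 2 * L * (?n / sqrt ?n) * (\<tau> powr \<beta> / \<tau>) * norm u"
    by (simp add: mult_ac)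
  also have "?n / sqrt ?n = sqrt ?n" by (simp add: real_div_sqrt)
  also have "\<tau> powr \<beta> / \<tau> = \<tau> powr (\<beta> - 1)" using \<tau> by (simp add: powr_diff)
  finally have le: "?n / (2 * \<tau>) * \<bar>((LINT w|draw_law. ?F \<tau> w) - (LINT w|draw_law. ?F (- \<tau>) w))
      - 2 * \<tau> / ?n * (grad f x \<bullet> u)\<bar> \<le> \<kappa>\<beta> / 2 * L * sqrt ?n * \<tau> powr (\<beta> - 1) * norm u" .
  have "\<bar>?n / (2 * \<tau>) * d - g\<bar> = ?n / (2 * \<tau>) * \<bar>d - 2 * \<tau> / ?n * g\<bar>" for d g
  proof -
    have "?n / (2 * \<tau>) * d - g = ?n / (2 * \<tau>) * (d - 2 * \<tau> / ?n * g)"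
      using \<tau> n by (simp add: field_simps)
    then show ?thesis using \<tau> n by (simp add: abs_mult)
  qed
  then show ?thesis unfolding eq using le by metis
qed

lemma fourth_moment_bounds_second:
  fixes h :: "'a \<Rightarrow> real"
  assumes A: "prob_space A" and "integrable A (\<lambda>v. (h v)\<^sup>2)" "integrable A (\<lambda>v. (h v) ^ 4)"
    and le: "sqrt (LINT v|A. (h v) ^ 4) \<le> C"
  shows "(LINT v|A. (h v)\<^sup>2) \<le> C"
proof -
  have "(LINT v|A. (h v)\<^sup>2)\<^sup>2 \<le> (LINT v|A. ((h v)\<^sup>2)\<^sup>2)"
    by (rule square_integral_le) (use assms in auto)
  then have "(LINT v|A. (h v)\<^sup>2) \<le> sqrt (LINT v|A. (h v) ^ 4)"
    by (intro real_le_rsqrt) simp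
  with le show ?thesis by simp
qed

text \<open>On the sphere the symmetric difference is odd in \<open>v\<close>, so its mean is \<open>0\<close>, and the concentration
  bound for Lipschitz functions controls its fourth and hence its second moment. Precomposition with
  the projection onto the unit ball, which changes nothing on the sphere, makes it Lipschitz on the
  whole space although \<open>f\<close> is known to be Lipschitz only near \<open>x\<close>.\<close>

lemma symmetric_difference_second_moment:
  fixes f :: "real^'n::finite \<Rightarrow> real"
  assumes cont: "continuous_on UNIV f" and lip: "G-lipschitz_on (ball x \<rho>') f" and \<rho>: "\<bar>\<rho>\<bar> < \<rho>'"
    and c: "\<And>(h :: real^'n \<Rightarrow> real) H. H-lipschitz_on UNIV h \<Longrightarrow>
         sqrt (LINT v|uniform_sphere. (h v - (LINT w|uniform_sphere. h w)) ^ 4) \<le> c * H\<^sup>2 / real CARD('n)"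
  shows "(LINT v|uniform_sphere. (f (x + \<rho> *\<^sub>R v) - f (x - \<rho> *\<^sub>R v))\<^sup>2)
    \<le> c * (2 * G * \<bar>\<rho>\<bar>)\<^sup>2 / real CARD('n)"
proof -
  let ?S = "uniform_sphere :: (real^'n) measure"
  let ?P = "closest_point (cball 0 1 :: (real^'n) set)"
  define h where "h v = f (x + \<rho> *\<^sub>R ?P v) - f (x - \<rho> *\<^sub>R ?P v)" for v
  have G: "0 \<le> G" using lip by (rule lipschitz_on_nonneg)
  have fm[measurable]: "f \<in> borel_measurable borel" by (rule borel_measurable_continuous_onI[OF cont])
  have P_in: "norm (?P v) \<le> 1" for v
    using closest_point_in_set[of "cball 0 1 :: (real^'n) set" v] by simp
  have P_id: "?P v = v" if "norm v = 1" for v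
    using that by (intro closest_point_self) simp
  have P_lip: "dist (?P v) (?P w) \<le> dist v w" for v w
    by (rule closest_point_lipschitz) auto
  have in_ball: "x + r *\<^sub>R ?P v \<in> ball x \<rho>'" if "\<bar>r\<bar> = \<bar>\<rho>\<bar>" for r v
  proof -
    have "\<bar>r\<bar> * norm (?P v) \<le> \<bar>\<rho>\<bar>" using P_in[of v] that by (simp add: mult_left_le)
    then show ?thesis using \<rho> by (simp add: dist_norm)
  qed
  have one: "\<bar>f (x + r *\<^sub>R ?P v) - f (x + r *\<^sub>R ?P w)\<bar> \<le> G * (\<bar>\<rho>\<bar> * dist v w)" if "\<bar>r\<bar> = \<bar>\<rho>\<bar>" for r v w
  proof -
    have "\<bar>f (x + r *\<^sub>R ?P v) - f (x + r *\<^sub>R ?P w)\<bar> \<le> G * dist (x + r *\<^sub>R ?P v) (x + r *\<^sub>R ?P w)"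
      using lipschitz_onD[OF lip in_ball[OF that] in_ball[OF that]] by (simp add: dist_real_def)
    also have "dist (x + r *\<^sub>R ?P v) (x + r *\<^sub>R ?P w) = \<bar>\<rho>\<bar> * dist (?P v) (?P w)"
      using that by (simp add: dist_norm flip: scaleR_diff_right)
    also have "G * (\<bar>\<rho>\<bar> * dist (?P v) (?P w)) \<le> G * (\<bar>\<rho>\<bar> * dist v w)"
      using G P_lip by (intro mult_left_mono) auto
    finally show ?thesis .
  qed
  have hlip: "(2 * G * \<bar>\<rho>\<bar>)-lipschitz_on UNIV h"
  proof (rule lipschitz_onI)
    fix v w :: "real^'n"
    show "dist (h v) (h w) \<le> 2 * G * \<bar>\<rho>\<bar> * dist v w"
      using one[of \<rho> v w] one[of "- \<rho>" v w] by (simp add: h_def dist_real_def)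
  qed (use G in simp)
  then have hcont: "continuous_on UNIV h" by (rule lipschitz_on_continuous_on)
  have hm[measurable]: "h \<in> borel_measurable borel" by (rule borel_measurable_continuous_onI[OF hcont])
  obtain B where B: "\<And>v. v \<in> cball 0 1 \<Longrightarrow> \<bar>h v\<bar> \<le> B" using bounded_on_cball[OF hcont] by blast
  have hint: "integrable ?S (\<lambda>v. (h v) ^ k)" for k
    by (rule integrable_uniform_sphere[of _ "B ^ k"])
       (use B in \<open>auto simp: power_abs intro!: power_mono\<close>)
  have h_sphere: "AE v in ?S. h v = f (x + \<rho> *\<^sub>R v) - f (x - \<rho> *\<^sub>R v)"
    using AE_uniform_sphere_norm by eventually_elim (simp add: h_def P_id)
  have "(LINT v|?S. h v) = (LINT v|?S. h (- v))"
    by (rule integral_uniform_sphere_uminus[symmetric]) simp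
  also have "\<dots> = (LINT v|?S. - h v)"
  proof (rule integral_cong_AE)
    show "AE v in ?S. h (- v) = - h v"
      using AE_uniform_sphere_norm by eventually_elim (simp add: h_def P_id)
  qed auto
  finally have h0: "(LINT v|?S. h v) = 0" by simp
  have "(LINT v|?S. (f (x + \<rho> *\<^sub>R v) - f (x - \<rho> *\<^sub>R v))\<^sup>2) = (LINT v|?S. (h v)\<^sup>2)"
    by (rule integral_cong_AE) (use h_sphere in \<open>auto elim: AE_mp\<close>)
  also have "\<dots> \<le> c * (2 * G * \<bar>\<rho>\<bar>)\<^sup>2 / real CARD('n)"
    using c[OF hlip] by (intro fourth_moment_bounds_second[OF prob_space_uniform_sphere] hint) (simp add: h0)
  finally show ?thesis .
qed

lemma norm_grad_estimate_le:
  fixes x v :: "real^'n::finite"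
  assumes "norm v = 1"
  shows "(norm (grad_estimate f K \<tau> s v a b x))\<^sup>2 \<le> 3 * (real CARD('n) / (2 * \<tau>))\<^sup>2 *
    (((f (x + (\<tau> * s) *\<^sub>R v) - f (x - (\<tau> * s) *\<^sub>R v))\<^sup>2 + a\<^sup>2 + b\<^sup>2) * (K s)\<^sup>2)"
proof -
  let ?d = "f (x + (\<tau> * s) *\<^sub>R v) - f (x - (\<tau> * s) *\<^sub>R v)"
  have "(norm (grad_estimate f K \<tau> s v a b x))\<^sup>2
      = (real CARD('n) / (2 * \<tau>))\<^sup>2 * ((?d + a - b)\<^sup>2 * (K s)\<^sup>2)"
  proof -
    have "grad_estimate f K \<tau> s v a b x = (real CARD('n) / (2 * \<tau>) * (?d + a - b) * K s) *\<^sub>R v"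
      unfolding grad_estimate_def Let_def by (rule arg_cong[of _ _ "\<lambda>y. y *\<^sub>R v"]) simp
    then have "(norm (grad_estimate f K \<tau> s v a b x))\<^sup>2 = (real CARD('n) / (2 * \<tau>) * (?d + a - b) * K s)\<^sup>2"
      using assms by (simp only: norm_scaleR power_mult_distrib power2_abs) simp
    then show ?thesis by (simp only: power_mult_distrib mult.assoc)
  qed
  also have "\<dots> \<le> (real CARD('n) / (2 * \<tau>))\<^sup>2 * (3 * (?d\<^sup>2 + a\<^sup>2 + b\<^sup>2) * (K s)\<^sup>2)"
  proof (intro mult_left_mono mult_right_mono)
    have "3 * (?d\<^sup>2 + a\<^sup>2 + b\<^sup>2) - (?d + a - b)\<^sup>2 = (?d - a)\<^sup>2 + (?d + b)\<^sup>2 + (a + b)\<^sup>2"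
      by (simp add: power2_eq_square algebra_simps)
    moreover have "0 \<le> (?d - a)\<^sup>2 + (?d + b)\<^sup>2 + (a + b)\<^sup>2" by simp
    ultimately show "(?d + a - b)\<^sup>2 \<le> 3 * (?d\<^sup>2 + a\<^sup>2 + b\<^sup>2)" by linarith
  qed auto
  finally show ?thesis by (simp only: mult_ac)
qed

text \<open>The difference of the two values of \<open>f\<close> is of order \<open>G * \<tau> / sqrt n\<close> by concentration, so the noiseless
  part of the second moment grows only linearly in \<open>n\<close> and does not blow up as \<open>\<tau>\<close> tends to \<open>0\<close>. The
  noise part is of order \<open>n\<^sup>2 / \<tau>\<^sup>2\<close>.\<close>

lemma grad_estimate_second_moment:
  fixes f :: "real^'n::finite \<Rightarrow> real" and x :: "real^'n"
  assumes cont: "continuous_on UNIV f" and lip: "G-lipschitz_on (ball x \<tau>) f" and \<tau>: "0 < \<tau>"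
    and K: "smoothing_kernel \<beta> K" "set_integrable lborel {-1..1} (\<lambda>u. (K u)\<^sup>2)"
    and c0: "0 \<le> c"
    and c: "\<And>(h :: real^'n \<Rightarrow> real) H. H-lipschitz_on UNIV h \<Longrightarrow>
         sqrt (LINT v|uniform_sphere. (h v - (LINT w|uniform_sphere. h w)) ^ 4) \<le> c * H\<^sup>2 / real CARD('n)"
  defines "\<kappa> \<equiv> (LINT u:{-1..1}|lborel. (K u)\<^sup>2)"
  shows "integrable draw_law (\<lambda>w. (norm (grad_estimate f K \<tau> (snd w) (fst w) a b x))\<^sup>2)"
    and "(LINT w|draw_law. (norm (grad_estimate f K \<tau> (snd w) (fst w) a b x))\<^sup>2)
      \<le> \<kappa> / 2 * (3 * c * real CARD('n) * G\<^sup>2 + 3 * (real CARD('n) / (2 * \<tau>))\<^sup>2 * (a\<^sup>2 + b\<^sup>2))"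
proof -
  let ?S = "uniform_sphere :: (real^'n) measure"
  let ?U = uniform_interval
  let ?n = "real CARD('n)"
  let ?g = "\<lambda>w. (norm (grad_estimate f K \<tau> (snd w) (fst w) a b x))\<^sup>2"
  let ?d = "\<lambda>s v. f (x + (\<tau> * s) *\<^sub>R v) - f (x - (\<tau> * s) *\<^sub>R v)"
  let ?B = "\<lambda>w. ((?d (snd w) (fst w))\<^sup>2 + a\<^sup>2 + b\<^sup>2) * (K (snd w))\<^sup>2"
  have n: "0 < ?n" by simp
  interpret P: pair_prob_space ?S ?U by (rule pair_prob_space_draw_law)
  have fm[measurable]: "f \<in> borel_measurable borel" by (rule borel_measurable_continuous_onI[OF cont])
  have Km[measurable]: "K \<in> borel_measurable borel" by (rule smoothing_kernel_measurable[OF K(1)])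
  note kap = kernel_uniform_moments(2)[OF K] kernel_uniform_moments(3)[OF K(1), folded \<kappa>_def]
  obtain C where C: "\<And>y. y \<in> cball x \<tau> \<Longrightarrow> \<bar>f y\<bar> \<le> C" using bounded_on_cball[OF cont] by blast
  have d_le: "\<bar>?d s v\<bar> \<le> 2 * C" if "norm v = 1" "\<bar>s\<bar> < 1" for s v
  proof -
    have "\<bar>\<tau> * s\<bar> \<le> \<tau>" using that \<tau> by (simp add: abs_mult mult_left_le)
    then have "\<bar>f (x + (\<tau> * s) *\<^sub>R v)\<bar> \<le> C" "\<bar>f (x - (\<tau> * s) *\<^sub>R v)\<bar> \<le> C"
      using that by (auto intro!: C simp: dist_norm)
    then show ?thesis by linarith
  qed
  have d2_le: "(?d s v)\<^sup>2 \<le> (2 * C)\<^sup>2" if "norm v = 1" "\<bar>s\<bar> < 1" for s v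
    using d_le[OF that] unfolding abs_le_square_iff[symmetric] by linarith
  have Bm: "?B \<in> borel_measurable borel"
    unfolding borel_prod[symmetric] by measurable
  have Bint: "integrable draw_law ?B"
  proof (rule integrable_draw_law_bound[OF Bm kap(1)])
    fix v :: "real^'n" and s :: real assume v: "norm v = 1" and s: "\<bar>s\<bar> < 1"
    have "(?d s v)\<^sup>2 + a\<^sup>2 + b\<^sup>2 \<le> (2 * C)\<^sup>2 + a\<^sup>2 + b\<^sup>2" using d2_le[OF v s] by simp
    then have "((?d s v)\<^sup>2 + a\<^sup>2 + b\<^sup>2) * (K s)\<^sup>2 \<le> ((2 * C)\<^sup>2 + a\<^sup>2 + b\<^sup>2) * (K s)\<^sup>2"
      by (intro mult_right_mono) auto
    then show "\<bar>?B (v, s)\<bar> \<le> ((2 * C)\<^sup>2 + a\<^sup>2 + b\<^sup>2) * \<bar>(K s)\<^sup>2\<bar>"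
      by (simp add: abs_mult)
  qed
  have gm: "?g \<in> borel_measurable draw_law"
    unfolding grad_estimate_def Let_def by measurable
  have g_le: "AE w in draw_law. ?g w \<le> 3 * (?n / (2 * \<tau>))\<^sup>2 * ?B w"
    using AE_draw_law by eventually_elim (intro norm_grad_estimate_le, simp)
  have Bint': "integrable draw_law (\<lambda>w. 3 * (?n / (2 * \<tau>))\<^sup>2 * ?B w)"
    using Bint by (rule integrable_mult_right)
  show gint: "integrable draw_law ?g"
    using Bint' gm by (rule Bochner_Integration.integrable_bound) (use g_le in \<open>auto elim: AE_mp\<close>)
  have inner: "(LINT v|?S. ?B (v, s)) \<le> (4 * c * G\<^sup>2 * \<tau>\<^sup>2 / ?n + a\<^sup>2 + b\<^sup>2) * (K s)\<^sup>2" if s: "\<bar>s\<bar> < 1" for s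
  proof -
    have dint: "integrable ?S (\<lambda>v. (?d s v)\<^sup>2)"
      by (rule integrable_uniform_sphere[of _ "(2 * C)\<^sup>2"]) (use d2_le s in auto)
    have lt: "\<bar>\<tau> * s\<bar> < \<tau>" using s \<tau> by (simp add: abs_mult)
    have "(LINT v|?S. (?d s v)\<^sup>2) \<le> c * (2 * G * \<bar>\<tau> * s\<bar>)\<^sup>2 / ?n"
      by (rule symmetric_difference_second_moment[OF cont lip lt c])
    also have "\<dots> \<le> c * (2 * G * \<tau>)\<^sup>2 / ?n"
      using lt c0 \<tau> lipschitz_on_nonneg[OF lip]
      by (intro divide_right_mono mult_left_mono power_mono) (auto simp: mult_left_mono)
    finally have d: "(LINT v|?S. (?d s v)\<^sup>2) \<le> 4 * c * G\<^sup>2 * \<tau>\<^sup>2 / ?n"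
      by (simp add: power_mult_distrib mult_ac)
    have "(LINT v|?S. ?B (v, s)) = (LINT v|?S. (?d s v)\<^sup>2 + a\<^sup>2 + b\<^sup>2) * (K s)\<^sup>2"
      by simp
    also have "(LINT v|?S. (?d s v)\<^sup>2 + a\<^sup>2 + b\<^sup>2) = (LINT v|?S. (?d s v)\<^sup>2) + a\<^sup>2 + b\<^sup>2"
      using dint P.M1.prob_space by simp
    finally have eq: "(LINT v|?S. ?B (v, s)) = ((LINT v|?S. (?d s v)\<^sup>2) + a\<^sup>2 + b\<^sup>2) * (K s)\<^sup>2" .
    show ?thesis unfolding eq using d by (intro mult_right_mono) auto
  qed
  have "(LINT w|draw_law. ?B w) = (LINT s|?U. LINT v|?S. ?B (v, s))"
    using P.integral_snd[of "\<lambda>v s. ?B (v, s)"] Bint by (simp add: case_prod_unfold)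
  also have "\<dots> \<le> (LINT s|?U. (4 * c * G\<^sup>2 * \<tau>\<^sup>2 / ?n + a\<^sup>2 + b\<^sup>2) * (K s)\<^sup>2)"
  proof (rule integral_mono_AE)
    show "integrable ?U (\<lambda>s. LINT v|?S. ?B (v, s))"
      using P.integrable_snd[of "\<lambda>v s. ?B (v, s)"] Bint by (simp add: case_prod_unfold)
    show "integrable ?U (\<lambda>s. (4 * c * G\<^sup>2 * \<tau>\<^sup>2 / ?n + a\<^sup>2 + b\<^sup>2) * (K s)\<^sup>2)"
      using kap(1) by (rule integrable_mult_right)
    show "AE s in ?U. (LINT v|?S. ?B (v, s)) \<le> (4 * c * G\<^sup>2 * \<tau>\<^sup>2 / ?n + a\<^sup>2 + b\<^sup>2) * (K s)\<^sup>2"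
      using AE_uniform_interval by eventually_elim (rule inner)
  qed
  also have "\<dots> = (4 * c * G\<^sup>2 * \<tau>\<^sup>2 / ?n + a\<^sup>2 + b\<^sup>2) * (\<kappa> / 2)"
    by (simp add: kap(2))
  finally have B_le: "(LINT w|draw_law. ?B w) \<le> (4 * c * G\<^sup>2 * \<tau>\<^sup>2 / ?n + a\<^sup>2 + b\<^sup>2) * (\<kappa> / 2)" .
  have "(LINT w|draw_law. ?g w) \<le> (LINT w|draw_law. 3 * (?n / (2 * \<tau>))\<^sup>2 * ?B w)"
    by (rule integral_mono_AE[OF gint Bint' g_le])
  also have "\<dots> = 3 * (?n / (2 * \<tau>))\<^sup>2 * (LINT w|draw_law. ?B w)"
    by (rule integral_mult_right_zero)
  also have "\<dots> \<le> 3 * (?n / (2 * \<tau>))\<^sup>2 * ((4 * c * G\<^sup>2 * \<tau>\<^sup>2 / ?n + a\<^sup>2 + b\<^sup>2) * (\<kappa> / 2))"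
    using B_le by (intro mult_left_mono) auto
  also have "\<dots> = \<kappa> / 2 * (3 * c * ?n * G\<^sup>2 + 3 * (?n / (2 * \<tau>))\<^sup>2 * (a\<^sup>2 + b\<^sup>2))"
    using \<tau> n by (simp add: field_simps power2_eq_square)
  finally show "(LINT w|draw_law. ?g w)
      \<le> \<kappa> / 2 * (3 * c * ?n * G\<^sup>2 + 3 * (?n / (2 * \<tau>))\<^sup>2 * (a\<^sup>2 + b\<^sup>2))" .
qed

section \<open>One step of the algorithm in expectation\<close>

lemma projection_step:
  fixes Q :: "'a::euclidean_space set"
  assumes Q: "convex Q" "closed Q" and z: "z \<in> Q"
  shows "(norm (closest_point Q (x - \<alpha> *\<^sub>R g) - z))\<^sup>2
    \<le> (norm (x - z))\<^sup>2 - 2 * \<alpha> * (g \<bullet> (x - z)) + \<alpha>\<^sup>2 * (norm g)\<^sup>2"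
proof -
  have "dist (closest_point Q (x - \<alpha> *\<^sub>R g)) (closest_point Q z) \<le> dist (x - \<alpha> *\<^sub>R g) z"
    using Q z by (intro closest_point_lipschitz) auto
  then have "norm (closest_point Q (x - \<alpha> *\<^sub>R g) - z) \<le> norm ((x - z) - \<alpha> *\<^sub>R g)"
    using closest_point_self[OF z] by (simp add: dist_norm algebra_simps)
  then have "(norm (closest_point Q (x - \<alpha> *\<^sub>R g) - z))\<^sup>2 \<le> (norm ((x - z) - \<alpha> *\<^sub>R g))\<^sup>2"
    by (rule power_mono) simp
  also have "\<dots> = (norm (x - z))\<^sup>2 - 2 * \<alpha> * (g \<bullet> (x - z)) + \<alpha>\<^sup>2 * (norm g)\<^sup>2"
    unfolding power2_norm_eq_inner
    by (simp add: inner_diff_left inner_diff_right inner_commute power2_eq_square algebra_simps)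
  finally show ?thesis .
qed

lemma continuous_on_strongly_convex_holder_class:
  assumes "f \<in> strongly_convex_holder_class Q \<epsilon>0 \<gamma> \<beta> L" "2 < \<beta>"
  shows "continuous_on UNIV f"
proof -
  have "times_differentiable (holder_order \<beta>) f"
    using assms(1) by (simp add: strongly_convex_holder_class_def holder_class_def)
  moreover obtain l where "holder_order \<beta> = Suc l"
    using two_le_holder_order[OF assms(2)] by (cases "holder_order \<beta>") auto
  ultimately show ?thesis by (auto intro: differentiable_imp_continuous_on)
qed

lemma grad_estimate_measurable:
  fixes f :: "real^'n::finite \<Rightarrow> real"
  assumes f: "f \<in> borel_measurable borel" and K: "K \<in> borel_measurable borel"
    and meas: "a \<in> borel_measurable M" "b \<in> borel_measurable M" "s \<in> borel_measurable M"
      "v \<in> borel_measurable M" "x \<in> borel_measurable M"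
  shows "(\<lambda>z. grad_estimate f K \<tau> (s z) (v z) (a z) (b z) (x z)) \<in> borel_measurable M"
proof -
  note [measurable] = assms
  show ?thesis unfolding grad_estimate_def Let_def by measurable
qed

lemma le_one_plus_square: "t \<le> 1 + t\<^sup>2" for t :: real
proof -
  have "1 + t\<^sup>2 - t = (t - 1 / 2)\<^sup>2 + 3 / 4" by (simp add: power2_eq_square algebra_simps)
  moreover have "0 \<le> (t - 1 / 2)\<^sup>2" by simp
  ultimately show ?thesis by linarith
qed

text \<open>The projection inequality is averaged over the fresh draw. Half of the quadratic term of strong
  convexity is spent on the bias, through
  \<open>b * norm u \<le> b\<^sup>2 / \<gamma> + \<gamma> / 4 * (norm u)\<^sup>2\<close>; the other half remains and drives the telescoping. The
  gradient is eliminated pointwise, before the expectation over the state, so that of \<open>f\<close> only values are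
  integrated.\<close>

lemma expected_step:
  fixes f :: "real^'n::finite \<Rightarrow> real" and M :: "'w measure"
    and X e :: "'w \<Rightarrow> real^'n" and r \<xi> \<xi>' :: "'w \<Rightarrow> real"
  assumes M: "prob_space M"
    and indep: "indep_rvs M (borel \<Otimes>\<^sub>M borel) (\<lambda>\<omega>. (X \<omega>, (\<xi> \<omega>, \<xi>' \<omega>))) borel (\<lambda>\<omega>. (e \<omega>, r \<omega>))"
    and law: "distr M borel (\<lambda>\<omega>. (e \<omega>, r \<omega>)) = draw_law"
    and noise: "integrable M (\<lambda>\<omega>. (\<xi> \<omega>)\<^sup>2)" "(LINT \<omega>|M. (\<xi> \<omega>)\<^sup>2) \<le> \<sigma>\<^sup>2"
      "integrable M (\<lambda>\<omega>. (\<xi>' \<omega>)\<^sup>2)" "(LINT \<omega>|M. (\<xi>' \<omega>)\<^sup>2) \<le> \<sigma>\<^sup>2"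
    and Q: "convex Q" "compact Q" and X: "\<And>\<omega>. \<omega> \<in> space M \<Longrightarrow> X \<omega> \<in> Q" and z: "z \<in> Q"
    and f: "f \<in> strongly_convex_holder_class Q \<epsilon>0 \<gamma> \<beta> L" and \<gamma>: "0 < \<gamma>" and L: "0 \<le> L" and \<beta>: "2 < \<beta>"
    and K: "smoothing_kernel \<beta> K" "set_integrable lborel {-1..1} (\<lambda>u. (K u)\<^sup>2)"
    and \<tau>: "0 < \<tau>" "\<tau> \<le> \<epsilon>0" and lip: "G-lipschitz_on (nbhd Q \<tau>) f"
    and c0: "0 \<le> c"
    and c: "\<And>(h :: real^'n \<Rightarrow> real) H. H-lipschitz_on UNIV h \<Longrightarrow>
         sqrt (LINT v|uniform_sphere. (h v - (LINT w|uniform_sphere. h w)) ^ 4) \<le> c * H\<^sup>2 / real CARD('n)"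
    and \<alpha>: "0 < \<alpha>"
    and step: "\<And>\<omega>. \<omega> \<in> space M \<Longrightarrow>
      X' \<omega> = closest_point Q (X \<omega> - \<alpha> *\<^sub>R grad_estimate f K \<tau> (r \<omega>) (e \<omega>) (\<xi> \<omega>) (\<xi>' \<omega>) (X \<omega>))"
  defines "\<kappa> \<equiv> (LINT u:{-1..1}|lborel. (K u)\<^sup>2)"
    and "\<kappa>\<beta> \<equiv> (LINT u:{-1..1}|lborel. \<bar>u\<bar> powr \<beta> * \<bar>K u\<bar>)"
  shows "2 * \<alpha> * ((LINT \<omega>|M. f (X \<omega>) - f z) + \<gamma> / 4 * (LINT \<omega>|M. (norm (X \<omega> - z))\<^sup>2)
        - (\<kappa>\<beta> / 2 * L * sqrt (real CARD('n)) * \<tau> powr (\<beta> - 1))\<^sup>2 / \<gamma>)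
      + (LINT \<omega>|M. (norm (X' \<omega> - z))\<^sup>2)
    \<le> (LINT \<omega>|M. (norm (X \<omega> - z))\<^sup>2)
      + \<alpha>\<^sup>2 * (\<kappa> / 2 * (3 * c * real CARD('n) * G\<^sup>2 + 6 * (real CARD('n) / (2 * \<tau>))\<^sup>2 * \<sigma>\<^sup>2))"
proof -
  interpret prob_space M by fact
  let ?n = "real CARD('n)"
  define b where "b = \<kappa>\<beta> / 2 * L * sqrt ?n * \<tau> powr (\<beta> - 1)"
  define V where "V = \<kappa> / 2 * (3 * c * ?n * G\<^sup>2 + 6 * (?n / (2 * \<tau>))\<^sup>2 * \<sigma>\<^sup>2)"
  let ?g = "\<lambda>\<omega>. grad_estimate f K \<tau> (r \<omega>) (e \<omega>) (\<xi> \<omega>) (\<xi>' \<omega>) (X \<omega>)"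
  let ?u = "\<lambda>\<omega>. X \<omega> - z"
  have cont: "continuous_on UNIV f" by (rule continuous_on_strongly_convex_holder_class[OF f \<beta>])
  have fm[measurable]: "f \<in> borel_measurable borel" by (rule borel_measurable_continuous_onI[OF cont])
  have Km[measurable]: "K \<in> borel_measurable borel" by (rule smoothing_kernel_measurable[OF K(1)])
  have Zm[measurable]: "(\<lambda>\<omega>. (X \<omega>, (\<xi> \<omega>, \<xi>' \<omega>))) \<in> measurable M (borel \<Otimes>\<^sub>M borel)"
    and Wm: "(\<lambda>\<omega>. (e \<omega>, r \<omega>)) \<in> borel_measurable M"
    using indep by (auto simp: indep_rvs_def)
  have Xm[measurable]: "X \<in> borel_measurable M"
    using measurable_compose[OF Zm measurable_fst] by simp
  have holder: "f \<in> holder_class Q \<epsilon>0 \<beta> L"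
    and sc: "\<And>x y. f x + grad f x \<bullet> (y - x) + \<gamma> / 2 * (norm (x - y))\<^sup>2 \<le> f y"
    using f by (auto simp: strongly_convex_holder_class_def)
  obtain R where R: "\<And>x. x \<in> Q \<Longrightarrow> norm (x - z) \<le> R"
    using compact_imp_bounded[OF Q(2)] bounded_any_center[of Q z] by (auto simp: dist_norm norm_minus_commute)
  obtain C where C: "\<And>x. x \<in> Q \<Longrightarrow> \<bar>f x\<bar> \<le> C"
    using bounded_on_cball[OF cont, of z R] R by (metis dist_norm mem_cball norm_minus_commute)
  have R0: "0 \<le> R" using R[OF z] by simp
  have lip_ball: "G-lipschitz_on (ball x \<tau>) f" if "x \<in> Q" for x
    using that by (intro lipschitz_on_subset[OF lip]) (auto simp: nbhd_def)

  \<comment> \<open>The estimate as a function of a nested pair: iterate and noise first, then the draw.\<close>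
  let ?N = "(borel \<Otimes>\<^sub>M borel) \<Otimes>\<^sub>M borel :: (((real^'n) \<times> (real \<times> real)) \<times> ((real^'n) \<times> real)) measure"
  let ?ge = "\<lambda>y. grad_estimate f K \<tau> (snd (snd y)) (fst (snd y)) (fst (snd (fst y))) (snd (snd (fst y))) (fst (fst y))"
  have gem[measurable]: "?ge \<in> borel_measurable ?N"
    unfolding borel_prod[symmetric]
    by (rule grad_estimate_measurable[OF fm Km]) measurable

  let ?\<phi> = "\<lambda>\<omega>. \<kappa> / 2 * (3 * c * ?n * G\<^sup>2 + 3 * (?n / (2 * \<tau>))\<^sup>2 * ((\<xi> \<omega>)\<^sup>2 + (\<xi>' \<omega>)\<^sup>2))"
  note second = grad_estimate_second_moment[OF cont lip_ball \<tau>(1) K c0 c, folded \<kappa>_def]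
  have \<phi>: "integrable M ?\<phi>" using noise by simp
  have norm_meas: "(\<lambda>y. (norm (?ge y))\<^sup>2) \<in> borel_measurable ?N" by measurable
  have bound: "integrable M (\<lambda>\<omega>. (norm (?g \<omega>))\<^sup>2)" "(LINT \<omega>|M. (norm (?g \<omega>))\<^sup>2) \<le> (LINT \<omega>|M. ?\<phi> \<omega>)"
    using indep_rvs_integrable_bound[OF M indep law norm_meas _ _ _ \<phi>] second X by auto
  have "(LINT \<omega>|M. ?\<phi> \<omega>) = \<kappa> / 2 * (3 * c * ?n * G\<^sup>2
      + 3 * (?n / (2 * \<tau>))\<^sup>2 * ((LINT \<omega>|M. (\<xi> \<omega>)\<^sup>2) + (LINT \<omega>|M. (\<xi>' \<omega>)\<^sup>2)))"
    using noise prob_space by simp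
  also have "\<dots> \<le> \<kappa> / 2 * (3 * c * ?n * G\<^sup>2 + 3 * (?n / (2 * \<tau>))\<^sup>2 * (2 * \<sigma>\<^sup>2))"
  proof -
    have "0 \<le> \<kappa>" unfolding \<kappa>_def set_lebesgue_integral_def by (rule integral_nonneg_AE) simp
    then show ?thesis using noise by (intro mult_left_mono add_left_mono) auto
  qed
  finally have V: "(LINT \<omega>|M. (norm (?g \<omega>))\<^sup>2) \<le> V"
    using bound(2) by (simp add: V_def algebra_simps)

  have inner_meas: "(\<lambda>y. ?ge y \<bullet> (fst (fst y) - z)) \<in> borel_measurable ?N" by measurable
  have gm: "?g \<in> borel_measurable M"
    using measurable_compose[OF measurable_Pair[OF Zm Wm] gem] by simp
  have inner_int: "integrable M (\<lambda>\<omega>. ?g \<omega> \<bullet> ?u \<omega>)"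
  proof (rule Bochner_Integration.integrable_bound)
    show "integrable M (\<lambda>\<omega>. R * (1 + (norm (?g \<omega>))\<^sup>2))" using bound(1) by simp
    show "(\<lambda>\<omega>. ?g \<omega> \<bullet> ?u \<omega>) \<in> borel_measurable M" using gm by measurable
    show "AE \<omega> in M. norm (?g \<omega> \<bullet> ?u \<omega>) \<le> norm (R * (1 + (norm (?g \<omega>))\<^sup>2))"
    proof (rule AE_I2)
      fix \<omega> assume "\<omega> \<in> space M"
      then have "\<bar>?g \<omega> \<bullet> ?u \<omega>\<bar> \<le> norm (?g \<omega>) * R"
        using Cauchy_Schwarz_ineq2[of "?g \<omega>" "?u \<omega>"] R[OF X] by (meson mult_left_mono norm_ge_zero order_trans)
      also have "norm (?g \<omega>) \<le> 1 + (norm (?g \<omega>))\<^sup>2"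
        by (rule le_one_plus_square)
      finally show "norm (?g \<omega> \<bullet> ?u \<omega>) \<le> norm (R * (1 + (norm (?g \<omega>))\<^sup>2))"
        using R0 by (simp add: mult_right_mono mult.commute abs_mult)
    qed
  qed
  let ?E = "\<lambda>\<omega>. LINT w|draw_law. grad_estimate f K \<tau> (snd w) (fst w) (\<xi> \<omega>) (\<xi>' \<omega>) (X \<omega>) \<bullet> ?u \<omega>"
  have cond: "integrable M ?E" "(LINT \<omega>|M. ?E \<omega>) = (LINT \<omega>|M. ?g \<omega> \<bullet> ?u \<omega>)"
    using indep_rvs_integral[OF M indep law inner_meas] inner_int by simp_all
  have pointwise: "f (X \<omega>) - f z + \<gamma> / 4 * (norm (?u \<omega>))\<^sup>2 - b\<^sup>2 / \<gamma> \<le> ?E \<omega>" if "\<omega> \<in> space M" for \<omega>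
  proof -
    have "\<bar>?E \<omega> - grad f (X \<omega>) \<bullet> ?u \<omega>\<bar> \<le> b * norm (?u \<omega>)"
      unfolding b_def \<kappa>\<beta>_def using grad_estimate_bias[OF cont holder L K(1) \<beta> X[OF that] \<tau>] by simp
    moreover have "f (X \<omega>) - f z + \<gamma> / 2 * (norm (?u \<omega>))\<^sup>2 \<le> grad f (X \<omega>) \<bullet> ?u \<omega>"
      using sc[of "X \<omega>" z] by (simp add: inner_diff_right)
    moreover have "b * norm (?u \<omega>) \<le> b\<^sup>2 / \<gamma> + \<gamma> / 4 * (norm (?u \<omega>))\<^sup>2"
    proof -
      have "b\<^sup>2 / \<gamma> + \<gamma> / 4 * (norm (?u \<omega>))\<^sup>2 - b * norm (?u \<omega>) = (b - \<gamma> / 2 * norm (?u \<omega>))\<^sup>2 / \<gamma>"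
        using \<gamma> by (simp add: power2_eq_square field_simps)
      also have "0 \<le> \<dots>" using \<gamma> by simp
      finally show ?thesis by simp
    qed
    ultimately show ?thesis unfolding abs_le_iff by (simp add: algebra_simps)
  qed
  have intf: "integrable M (\<lambda>\<omega>. f (X \<omega>) - f z)"
    by (rule integrable_const_bound[of _ "C + \<bar>f z\<bar>"]) (use C[OF X] in \<open>auto intro!: AE_I2 abs_triangle_ineq4[THEN order_trans]\<close>)
  have intu: "integrable M (\<lambda>\<omega>. (norm (?u \<omega>))\<^sup>2)"
    by (rule integrable_const_bound[of _ "R\<^sup>2"]) (use R[OF X] in \<open>auto intro!: AE_I2 power_mono\<close>)
  have "(LINT \<omega>|M. f (X \<omega>) - f z + \<gamma> / 4 * (norm (?u \<omega>))\<^sup>2 - b\<^sup>2 / \<gamma>) \<le> (LINT \<omega>|M. ?E \<omega>)"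
    using pointwise intf intu cond(1) by (intro integral_mono) auto
  also have "(LINT \<omega>|M. f (X \<omega>) - f z + \<gamma> / 4 * (norm (?u \<omega>))\<^sup>2 - b\<^sup>2 / \<gamma>)
      = (LINT \<omega>|M. f (X \<omega>) - f z) + \<gamma> / 4 * (LINT \<omega>|M. (norm (?u \<omega>))\<^sup>2) - b\<^sup>2 / \<gamma>"
  proof -
    have "(LINT \<omega>|M. (f (X \<omega>) - f z) + \<gamma> / 4 * (norm (?u \<omega>))\<^sup>2 - b\<^sup>2 / \<gamma>)
        = (LINT \<omega>|M. (f (X \<omega>) - f z) + \<gamma> / 4 * (norm (?u \<omega>))\<^sup>2) - (LINT \<omega>|M. b\<^sup>2 / \<gamma>)"
      using intf intu by (intro Bochner_Integration.integral_diff) auto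
    also have "(LINT \<omega>|M. (f (X \<omega>) - f z) + \<gamma> / 4 * (norm (?u \<omega>))\<^sup>2)
        = (LINT \<omega>|M. f (X \<omega>) - f z) + (LINT \<omega>|M. \<gamma> / 4 * (norm (?u \<omega>))\<^sup>2)"
      using intf intu by (intro Bochner_Integration.integral_add) auto
    finally show ?thesis using prob_space by simp
  qed
  finally have descent: "(LINT \<omega>|M. f (X \<omega>) - f z) + \<gamma> / 4 * (LINT \<omega>|M. (norm (?u \<omega>))\<^sup>2) - b\<^sup>2 / \<gamma>
      \<le> (LINT \<omega>|M. ?g \<omega> \<bullet> ?u \<omega>)" unfolding cond(2) .

  have int_rhs: "integrable M (\<lambda>\<omega>. (norm (?u \<omega>))\<^sup>2 - 2 * \<alpha> * (?g \<omega> \<bullet> ?u \<omega>))"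
    "integrable M (\<lambda>\<omega>. \<alpha>\<^sup>2 * (norm (?g \<omega>))\<^sup>2)"
    using intu inner_int bound(1) by simp_all
  have "(LINT \<omega>|M. (norm (X' \<omega> - z))\<^sup>2)
      \<le> (LINT \<omega>|M. (norm (?u \<omega>))\<^sup>2 - 2 * \<alpha> * (?g \<omega> \<bullet> ?u \<omega>) + \<alpha>\<^sup>2 * (norm (?g \<omega>))\<^sup>2)"
  proof (rule integral_mono')
    show "integrable M (\<lambda>\<omega>. (norm (?u \<omega>))\<^sup>2 - 2 * \<alpha> * (?g \<omega> \<bullet> ?u \<omega>) + \<alpha>\<^sup>2 * (norm (?g \<omega>))\<^sup>2)"
      using int_rhs by simp
    fix \<omega> assume \<omega>: "\<omega> \<in> space M"
    show le: "(norm (X' \<omega> - z))\<^sup>2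
        \<le> (norm (?u \<omega>))\<^sup>2 - 2 * \<alpha> * (?g \<omega> \<bullet> ?u \<omega>) + \<alpha>\<^sup>2 * (norm (?g \<omega>))\<^sup>2"
      unfolding step[OF \<omega>] by (rule projection_step) (use Q z compact_imp_closed in auto)
    show "0 \<le> (norm (?u \<omega>))\<^sup>2 - 2 * \<alpha> * (?g \<omega> \<bullet> ?u \<omega>) + \<alpha>\<^sup>2 * (norm (?g \<omega>))\<^sup>2"
      by (rule order_trans[OF _ le]) simp
  qed
  also have "\<dots> = (LINT \<omega>|M. (norm (?u \<omega>))\<^sup>2) - 2 * \<alpha> * (LINT \<omega>|M. ?g \<omega> \<bullet> ?u \<omega>)
      + \<alpha>\<^sup>2 * (LINT \<omega>|M. (norm (?g \<omega>))\<^sup>2)"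
    using int_rhs intu inner_int by simp
  also have "\<dots> \<le> (LINT \<omega>|M. (norm (?u \<omega>))\<^sup>2)
      - 2 * \<alpha> * ((LINT \<omega>|M. f (X \<omega>) - f z) + \<gamma> / 4 * (LINT \<omega>|M. (norm (?u \<omega>))\<^sup>2) - b\<^sup>2 / \<gamma>)
      + \<alpha>\<^sup>2 * V"
    using descent V \<alpha> by (intro add_mono diff_mono mult_left_mono) auto
  finally show ?thesis unfolding b_def V_def by linarith
qed

section \<open>The iterates as functions of the past\<close>

lemma iterate_in_set:
  assumes alg: "zo_spg f Q K \<alpha> \<tau> N x1 r e \<xi> \<xi>' x" and Q: "compact Q" and x1: "x1 \<in> Q"
    and k: "k \<in> {1..Suc N}"
  shows "x k \<in> Q"
proof (cases "k = 1")
  case True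
  then show ?thesis using alg x1 by (simp add: zo_spg_def)
next
  case False
  then obtain j where j: "k = Suc j" "j \<in> {1..N}" using k by (cases k) auto
  then have "x k = closest_point Q (x j - \<alpha> j *\<^sub>R grad_estimate f K (\<tau> j) (r j) (e j) (\<xi> j) (\<xi>' j) (x j))"
    using alg by (simp add: zo_spg_def)
  then show ?thesis using Q x1 compact_imp_closed closest_point_in_set by (metis empty_iff)
qed

text \<open>The freshness of a draw is stated relative to the earlier draws and noise values. Writing the iterate
  as a measurable function of these makes it independent of the current draw.\<close>

lemma iterate_function_of_past:
  fixes f :: "real^'n::finite \<Rightarrow> real"
  assumes alg: "\<And>\<omega>. \<omega> \<in> space M \<Longrightarrow>
         zo_spg f Q K \<alpha> \<tau> N x1 (\<lambda>k. r k \<omega>) (\<lambda>k. e k \<omega>) (\<lambda>k. \<xi> k \<omega>) (\<lambda>k. \<xi>' k \<omega>) (\<lambda>k. x k \<omega>)"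
    and f: "f \<in> borel_measurable borel" and K: "K \<in> borel_measurable borel"
    and Q: "convex Q" "compact Q" "x1 \<in> Q"
    and k: "1 \<le> k" "k \<le> Suc N"
  shows "\<exists>\<Phi> \<in> borel_measurable (\<Pi>\<^sub>M i\<in>{1..<k}. borel). \<forall>\<omega>\<in>space M.
    x k \<omega> = \<Phi> (\<lambda>i\<in>{1..<k}. (e i \<omega>, r i \<omega>, \<xi> i \<omega>, \<xi>' i \<omega>))"
  using k
proof (induction k rule: dec_induct)
  case base
  have "x 1 \<omega> = x1" if "\<omega> \<in> space M" for \<omega> using alg[OF that] by (simp add: zo_spg_def)
  then show ?case by (intro bexI[of _ "\<lambda>_. x1"]) auto
next
  case (step k)
  let ?P = "\<lambda>k. \<Pi>\<^sub>M i\<in>{1..<k}. borel :: ((real^'n) \<times> real \<times> real \<times> real) measure"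
  let ?past = "\<lambda>k \<omega>. \<lambda>i\<in>{1..<k}. (e i \<omega>, r i \<omega>, \<xi> i \<omega>, \<xi>' i \<omega>)"
  obtain \<Phi> where \<Phi>: "\<Phi> \<in> borel_measurable (?P k)" "\<And>\<omega>. \<omega> \<in> space M \<Longrightarrow> x k \<omega> = \<Phi> (?past k \<omega>)"
  proof -
    have "k \<le> Suc N" using step.prems by simp
    from step.IH[OF this] show ?thesis using that by blast
  qed
  let ?\<Phi>' = "\<lambda>p. \<Phi> (restrict p {1..<k})"
  let ?g = "\<lambda>p. grad_estimate f K (\<tau> k) (fst (snd (p k))) (fst (p k)) (fst (snd (snd (p k))))
    (snd (snd (snd (p k)))) (?\<Phi>' p)"
  let ?\<Psi> = "\<lambda>p. closest_point Q (?\<Phi>' p - \<alpha> k *\<^sub>R ?g p)"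
  have comp: "(\<lambda>p. p k) \<in> borel_measurable (?P (Suc k))"
    using step.hyps by (intro measurable_component_singleton) auto
  have proj[measurable]: "(\<lambda>p. h (p k)) \<in> borel_measurable (?P (Suc k))"
    if "continuous_on UNIV h" for h :: "(real^'n) \<times> real \<times> real \<times> real \<Rightarrow> 'b::topological_space"
    using measurable_compose[OF comp borel_measurable_continuous_onI[OF that]] .
  have \<Phi>'[measurable]: "?\<Phi>' \<in> borel_measurable (?P (Suc k))"
    by (rule measurable_compose[OF measurable_restrict_subset \<Phi>(1)]) auto
  have g[measurable]: "?g \<in> borel_measurable (?P (Suc k))"
    by (intro grad_estimate_measurable f K \<Phi>' proj continuous_intros)
  have cp[measurable]: "closest_point Q \<in> borel_measurable borel"
    using Q by (intro borel_measurable_continuous_onI continuous_on_closest_point) (auto intro: compact_imp_closed)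
  have \<Psi>: "?\<Psi> \<in> borel_measurable (?P (Suc k))" by measurable
  have "x (Suc k) \<omega> = ?\<Psi> (?past (Suc k) \<omega>)" if "\<omega> \<in> space M" for \<omega>
  proof -
    have r: "restrict (?past (Suc k) \<omega>) {1..<k} = ?past k \<omega>" by (auto simp: restrict_def)
    have pk: "?past (Suc k) \<omega> k = (e k \<omega>, r k \<omega>, \<xi> k \<omega>, \<xi>' k \<omega>)" using step.hyps by simp
    have "k \<in> {1..N}" using step.hyps step.prems by auto
    then have "x (Suc k) \<omega> = closest_point Q (x k \<omega>
        - \<alpha> k *\<^sub>R grad_estimate f K (\<tau> k) (r k \<omega>) (e k \<omega>) (\<xi> k \<omega>) (\<xi>' k \<omega>) (x k \<omega>))"
      using alg[OF that] unfolding zo_spg_def by blast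
    then show ?thesis
      by (simp only: r pk \<Phi>(2)[OF that] fst_conv snd_conv)
  qed
  then show ?case by (intro bexI[OF _ \<Psi>] ballI)
qed

lemma iterate_independent_of_draw:
  fixes f :: "real^'n::finite \<Rightarrow> real"
  assumes M: "prob_space M" and draws: "fresh_uniform_draws M N r e \<xi> \<xi>'"
    and alg: "\<And>\<omega>. \<omega> \<in> space M \<Longrightarrow>
         zo_spg f Q K \<alpha> \<tau> N x1 (\<lambda>k. r k \<omega>) (\<lambda>k. e k \<omega>) (\<lambda>k. \<xi> k \<omega>) (\<lambda>k. \<xi>' k \<omega>) (\<lambda>k. x k \<omega>)"
    and f: "f \<in> borel_measurable borel" and K: "K \<in> borel_measurable borel"
    and Q: "convex Q" "compact Q" "x1 \<in> Q"
    and k: "k \<in> {1..N}"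
  shows "indep_rvs M (borel \<Otimes>\<^sub>M borel) (\<lambda>\<omega>. (x k \<omega>, (\<xi> k \<omega>, \<xi>' k \<omega>))) borel (\<lambda>\<omega>. (e k \<omega>, r k \<omega>))"
proof -
  let ?past = "\<lambda>\<omega>. \<lambda>i\<in>{1..<k}. (e i \<omega>, r i \<omega>, \<xi> i \<omega>, \<xi>' i \<omega>)"
  obtain \<Phi> where \<Phi>[measurable]: "\<Phi> \<in> borel_measurable (\<Pi>\<^sub>M i\<in>{1..<k}. borel)"
    and x: "\<And>\<omega>. \<omega> \<in> space M \<Longrightarrow> x k \<omega> = \<Phi> (?past \<omega>)"
  proof -
    have "\<exists>\<Phi> \<in> borel_measurable (\<Pi>\<^sub>M i\<in>{1..<k}. borel). \<forall>\<omega>\<in>space M. x k \<omega> = \<Phi> (?past \<omega>)"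
      by (rule iterate_function_of_past[OF alg f K Q]) (use k in auto)
    then show ?thesis using that by blast
  qed
  have "indep_rvs M ((\<Pi>\<^sub>M i\<in>{1..<k}. borel) \<Otimes>\<^sub>M borel) (\<lambda>\<omega>. (?past \<omega>, (\<xi> k \<omega>, \<xi>' k \<omega>)))
      borel (\<lambda>\<omega>. (e k \<omega>, r k \<omega>))"
    using draws k by (simp add: fresh_uniform_draws_def)
  moreover have "(\<lambda>p. (\<Phi> (fst p), snd p)) \<in> measurable ((\<Pi>\<^sub>M i\<in>{1..<k}. borel) \<Otimes>\<^sub>M borel) (borel \<Otimes>\<^sub>M borel)"
    by measurable
  ultimately show ?thesis
    by (rule indep_rvs_compose[OF M]) (simp add: x)
qed

lemma distr_draw:
  assumes M: "prob_space M" and draws: "fresh_uniform_draws M N r e \<xi> \<xi>'"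
    and noise: "noise_assumption M N \<sigma> r e \<xi> \<xi>'" and k: "k \<in> {1..N}"
  shows "distr M borel (\<lambda>\<omega>. (e k \<omega>, r k \<omega>)) = draw_law"
proof -
  have "indep_rvs M borel (e k) borel (r k)" using noise k by (simp add: noise_assumption_def)
  from indep_rvs_distr[OF M this] show ?thesis
    using draws k by (simp add: fresh_uniform_draws_def borel_prod)
qed

section \<open>Summation of the step costs\<close>

lemma sum_inverse_le: "1 \<le> N \<Longrightarrow> (\<Sum>k=1..N. 1 / real k) \<le> 1 + ln (real N)"
proof (induction N rule: dec_induct)
  case (step N)
  have "ln (real N / real (Suc N)) \<le> real N / real (Suc N) - 1"
    using step.hyps by (intro ln_le_minus_one) simp
  also have "\<dots> = - 1 / real (Suc N)" by (simp add: field_simps)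
  finally have "1 / real (Suc N) \<le> ln (real (Suc N)) - ln (real N)"
    using step.hyps by (simp add: ln_div)
  then show ?case using step.IH step.hyps by simp
qed simp

lemma weighted_am_gm_one:
  fixes t q :: real
  assumes "0 < t" "0 \<le> q" "q \<le> 1"
  shows "t powr q \<le> 1 + q * (t - 1)"
  using Youngs_inequality_0[of q "1 - q" t 1] assms by (simp add: algebra_simps)

text \<open>Each term \<open>k powr (q - 1)\<close> is at most the increment \<open>(k powr q - (k - 1) powr q) / q\<close>, by the weighted
  mean inequality applied to \<open>(k - 1) / k\<close>.\<close>

lemma sum_powr_le:
  fixes q :: real
  assumes q: "0 < q" "q \<le> 1"
  shows "(\<Sum>k=1..N. real k powr (q - 1)) \<le> real N powr q / q"
proof (induction N)
  case (Suc N)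
  let ?m = "real (Suc N)"
  have "(real N / ?m) powr q \<le> 1 - q / ?m"
  proof (cases "N = 0")
    case False
    then have "(real N / ?m) powr q \<le> 1 + q * (real N / ?m - 1)"
      using q by (intro weighted_am_gm_one) auto
    also have "\<dots> = 1 - q / ?m" by (simp add: field_simps)
    finally show ?thesis .
  qed (use q in simp)
  then have "?m powr q * (real N / ?m) powr q \<le> ?m powr q * (1 - q / ?m)"
    by (intro mult_left_mono) auto
  also have "?m powr q * (real N / ?m) powr q = real N powr q"
    by (simp add: powr_divide)
  also have "?m powr q * (1 - q / ?m) = ?m powr q - q * ?m powr (q - 1)"
    by (simp add: powr_diff algebra_simps)
  finally have "?m powr (q - 1) \<le> (?m powr q - real N powr q) / q"
    using q by (simp add: field_simps)
  then show ?case using Suc.IH by (simp add: diff_divide_distrib)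
qed simp

text \<open>The radius satisfies \<open>\<tau> powr (2 * \<beta>) = B / k\<close>, which makes the squared bias a fixed multiple of the noise
  variance divided by \<open>k\<close>: both are proportional to \<open>1 / (k * \<tau>\<^sup>2)\<close>, that is, to
  \<open>k powr (1 / \<beta> - 1)\<close>.\<close>

lemma balanced_step_cost:
  fixes \<beta> B \<kappa> \<kappa>\<beta> L \<sigma> n c G \<tau> :: real and k :: nat
  assumes \<beta>: "2 < \<beta>" and n: "0 < n" and w: "0 < \<kappa>\<beta> * L" and k: "1 \<le> k"
    and B: "B = 3 * \<kappa> * \<sigma>\<^sup>2 * n / (2 * (\<beta> - 1) * (\<kappa>\<beta> * L)\<^sup>2)" "0 < B"
    and \<tau>: "\<tau> = B powr (1 / (2 * \<beta>)) * real k powr (- 1 / (2 * \<beta>))"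
  shows "(\<kappa>\<beta> / 2 * L * sqrt n * \<tau> powr (\<beta> - 1))\<^sup>2
      + \<kappa> / 2 * (3 * c * n * G\<^sup>2 + 6 * (n / (2 * \<tau>))\<^sup>2 * \<sigma>\<^sup>2) / real k
    = 3 / 4 * (1 + 1 / (2 * (\<beta> - 1))) * \<kappa> * \<sigma>\<^sup>2 * n\<^sup>2 * B powr (- 1 / \<beta>) * real k powr (1 / \<beta> - 1)
      + 3 * c * \<kappa> * G\<^sup>2 / 2 * n * (1 / real k)"
proof -
  have kr: "0 < real k" using k by simp
  have \<tau>0: "0 < \<tau>" using B(2) kr unfolding \<tau> by simp
  have "\<tau> powr (2 * \<beta>) = B / real k"
    using B(2) kr \<beta> unfolding \<tau> by (simp add: powr_mult powr_powr powr_minus_divide powr_divide)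
  moreover have "\<tau> powr (2 * \<beta>) = (\<tau> powr (\<beta> - 1))\<^sup>2 * \<tau>\<^sup>2"
  proof -
    have "(\<tau> powr (\<beta> - 1))\<^sup>2 * \<tau>\<^sup>2 = \<tau> powr (\<beta> - 1) * \<tau> powr (\<beta> - 1) * \<tau> powr 2"
      using \<tau>0 by (simp add: power2_eq_square)
    also have "\<dots> = \<tau> powr (2 * \<beta>)" unfolding powr_add[symmetric] by simp
    finally show ?thesis by simp
  qed
  ultimately have pow: "(\<tau> powr (\<beta> - 1))\<^sup>2 = B / (real k * \<tau>\<^sup>2)"
    using \<tau>0 kr by (simp add: field_simps)
  have "\<tau>\<^sup>2 = \<tau> powr 2" using \<tau>0 by simp
  also have "\<dots> = B powr (1 / \<beta>) * real k powr (- 1 / \<beta>)"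
    using B(2) kr unfolding \<tau> by (simp add: powr_mult powr_powr)
  finally have "1 / (real k * \<tau>\<^sup>2) = 1 / (B powr (1 / \<beta>) * (real k * real k powr (- 1 / \<beta>)))"
    by (simp add: mult_ac)
  also have "real k * real k powr (- 1 / \<beta>) = real k powr (1 - 1 / \<beta>)"
    using kr by (simp add: powr_mult_base)
  also have "1 / (B powr (1 / \<beta>) * real k powr (1 - 1 / \<beta>)) = B powr (- 1 / \<beta>) * real k powr (1 / \<beta> - 1)"
    using powr_minus_divide[of B "1 / \<beta>"] powr_minus_divide[of "real k" "1 - 1 / \<beta>"] by simp
  finally have inv: "1 / (real k * \<tau>\<^sup>2) = B powr (- 1 / \<beta>) * real k powr (1 / \<beta> - 1)" .
  have wB: "(\<kappa>\<beta> * L)\<^sup>2 * B = 3 * \<kappa> * \<sigma>\<^sup>2 * n / (2 * (\<beta> - 1))"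
  proof -
    have "p * (y / (d * p)) = y / d" if "p \<noteq> 0" for p y d :: real using that by simp
    moreover have "(\<kappa>\<beta> * L)\<^sup>2 \<noteq> 0" using w by auto
    ultimately show ?thesis unfolding B(1) by blast
  qed
  have "(\<kappa>\<beta> / 2 * L * sqrt n * \<tau> powr (\<beta> - 1))\<^sup>2 = ((\<kappa>\<beta> * L)\<^sup>2 * B) * n / 4 * (1 / (real k * \<tau>\<^sup>2))"
    using n by (simp add: power_mult_distrib power_divide pow mult_ac)
  also have "\<dots> = 3 / 4 * (1 / (2 * (\<beta> - 1))) * \<kappa> * \<sigma>\<^sup>2 * n\<^sup>2 * (1 / (real k * \<tau>\<^sup>2))"
    unfolding wB by (simp add: power2_eq_square)
  finally have bias: "(\<kappa>\<beta> / 2 * L * sqrt n * \<tau> powr (\<beta> - 1))\<^sup>2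
      = 3 / 4 * (1 / (2 * (\<beta> - 1))) * \<kappa> * \<sigma>\<^sup>2 * n\<^sup>2 * (1 / (real k * \<tau>\<^sup>2))" .
  have var: "\<kappa> / 2 * (3 * c * n * G\<^sup>2 + 6 * (n / (2 * \<tau>))\<^sup>2 * \<sigma>\<^sup>2) / real k
      = 3 / 4 * \<kappa> * \<sigma>\<^sup>2 * n\<^sup>2 * (1 / (real k * \<tau>\<^sup>2)) + 3 * c * \<kappa> * G\<^sup>2 / 2 * n * (1 / real k)"
    using \<tau>0 kr by (simp add: field_simps power2_eq_square)
  show ?thesis unfolding bias var inv by (simp add: algebra_simps)
qed

text \<open>Summation multiplies the cost by \<open>\<beta> * N powr (1 / \<beta>)\<close>; inserting \<open>B\<close> then gives the stated powers of
  \<open>n\<close>, \<open>N\<close>, the noise level and the smoothness constant. What remains is a purely numerical factor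
  depending on \<open>\<beta>\<close>, which is bounded because \<open>(2 * (\<beta> - 1) / 3) powr (1 / \<beta>) \<le> 5 / 3\<close>.\<close>

lemma balanced_rate:
  fixes \<beta> B \<kappa> \<kappa>\<beta> L \<sigma> n :: real
  assumes \<beta>: "2 < \<beta>" and n: "0 < n" and w: "0 < \<kappa>\<beta> * L" and \<kappa>\<sigma>: "0 < \<kappa> * \<sigma>\<^sup>2" and N: "1 \<le> N"
    and B: "B = 3 * \<kappa> * \<sigma>\<^sup>2 * n / (2 * (\<beta> - 1) * (\<kappa>\<beta> * L)\<^sup>2)"
  shows "3 / 4 * (1 + 1 / (2 * (\<beta> - 1))) * \<kappa> * \<sigma>\<^sup>2 * n\<^sup>2 * B powr (- 1 / \<beta>)
      * (\<Sum>k=1..N. real k powr (1 / \<beta> - 1)) / real N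
    \<le> n powr (2 - 1 / \<beta>)
      * (3 * \<beta> * (\<kappa> * \<sigma>\<^sup>2) powr ((\<beta> - 1) / \<beta>) * (\<kappa>\<beta> * L) powr (2 / \<beta>) / real N powr ((\<beta> - 1) / \<beta>))"
proof -
  define s where "s = \<kappa> * \<sigma>\<^sup>2"
  define W where "W = \<kappa>\<beta> * L"
  define \<rho> where "\<rho> = 2 * (\<beta> - 1) / 3"
  define q where "q = 1 / \<beta>"
  have pos: "0 < s" "0 < W" "0 < \<rho>" "0 < real N"
    using \<kappa>\<sigma> w \<beta> N by (auto simp: s_def W_def \<rho>_def)
  have q: "0 < q" "q < 1 / 2" using \<beta> by (auto simp: q_def)
  have q': "(\<beta> - 1) / \<beta> = 1 - q" "2 / \<beta> = 2 * q" "- 1 / \<beta> = - q" "1 / \<beta> = q"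
    using \<beta> by (auto simp: q_def diff_divide_distrib)
  have B_eq: "B = s * n / (\<rho> * W\<^sup>2)"
    unfolding B s_def W_def \<rho>_def by simp
  have Bq: "B powr (- q) = (\<rho> powr q * W powr (2 * q)) / (s powr q * n powr q)"
  proof -
    have "B powr (- q) = 1 / (B powr q)" by (rule powr_minus_divide)
    also have "B powr q = (s powr q * n powr q) / (\<rho> powr q * (W\<^sup>2) powr q)"
      unfolding B_eq using pos n by (simp add: powr_divide powr_mult)
    also have "(W\<^sup>2) powr q = W powr (2 * q)"
      using pos by (simp add: powr_powr flip: powr_numeral)
    finally show ?thesis by simp
  qed
  have "s * n\<^sup>2 * B powr (- q) = \<rho> powr q * W powr (2 * q) * ((s / s powr q) * (n\<^sup>2 / n powr q))"
    unfolding Bq by simp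
  also have "s / s powr q = s powr (1 - q)" using pos by (simp add: powr_diff)
  also have "n\<^sup>2 / n powr q = n powr (2 - q)" using n by (simp add: powr_diff)
  finally have main: "s * n\<^sup>2 * B powr (- q) = \<rho> powr q * (W powr (2 * q) * s powr (1 - q) * n powr (2 - q))"
    by (simp add: mult_ac)
  have "\<rho> powr q \<le> 1 + q * (\<rho> - 1)" using q pos by (intro weighted_am_gm_one) auto
  also have "\<dots> \<le> 5 / 3"
  proof -
    have "q * \<rho> = 2 / 3 * (1 - q)" using \<beta> by (simp add: q_def \<rho>_def field_simps)
    then show ?thesis using q by (simp add: algebra_simps)
  qed
  finally have \<rho>q: "\<rho> powr q \<le> 5 / 3" .
  have const: "3 / 4 * (1 + 1 / (2 * (\<beta> - 1))) * \<rho> powr q \<le> 3"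
  proof -
    have "1 / (2 * (\<beta> - 1)) \<le> 1 / 2" using \<beta> by (simp add: field_simps)
    then have "3 / 4 * (1 + 1 / (2 * (\<beta> - 1))) * \<rho> powr q \<le> 3 / 4 * (1 + 1 / 2) * (5 / 3)"
      using \<rho>q \<beta> by (intro mult_mono mult_left_mono) auto
    also have "\<dots> \<le> 3" by simp
    finally show ?thesis .
  qed
  have sumN: "(\<Sum>k=1..N. real k powr (q - 1)) / real N \<le> \<beta> * (1 / real N powr (1 - q))"
  proof -
    have "(\<Sum>k=1..N. real k powr (q - 1)) / real N \<le> (real N powr q / q) / real N"
      using q by (intro divide_right_mono sum_powr_le) auto
    also have "\<dots> = \<beta> * (1 / real N powr (1 - q))"
      using pos q \<beta> by (simp add: powr_diff q_def)
    finally show ?thesis .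
  qed
  let ?R = "W powr (2 * q) * s powr (1 - q) * n powr (2 - q)"
  have "3 / 4 * (1 + 1 / (2 * (\<beta> - 1))) * s * n\<^sup>2 * B powr (- q) * (\<Sum>k=1..N. real k powr (q - 1)) / real N
      = (3 / 4 * (1 + 1 / (2 * (\<beta> - 1)))) * (s * n\<^sup>2 * B powr (- q)) * ((\<Sum>k=1..N. real k powr (q - 1)) / real N)"
    by simp
  also have "\<dots> = (3 / 4 * (1 + 1 / (2 * (\<beta> - 1))) * \<rho> powr q) * ?R * ((\<Sum>k=1..N. real k powr (q - 1)) / real N)"
    unfolding main by (simp only: mult_ac)
  also have "\<dots> \<le> 3 * ?R * (\<beta> * (1 / real N powr (1 - q)))"
    using const sumN \<beta> by (intro mult_mono mult_right_mono) (auto intro!: sum_nonneg divide_nonneg_nonneg)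
  also have "\<dots> = n powr (2 - q) * (3 * \<beta> * s powr (1 - q) * W powr (2 * q) / real N powr (1 - q))"
    by simp
  finally show ?thesis unfolding q' s_def W_def by (simp only: mult.assoc)
qed

text \<open>Multiplying the recursion by \<open>\<gamma> * k / 4\<close> for the step size \<open>2 / (\<gamma> * k)\<close> turns the contraction term
  \<open>\<gamma> / 4 * a k\<close> into exactly what makes \<open>(k - 1) * a k - k * a (k + 1)\<close> telescope, without any
  contribution from \<open>a 1\<close>.\<close>

lemma telescoped_recursion:
  fixes D a C :: "nat \<Rightarrow> real"
  assumes \<gamma>: "0 < \<gamma>" and a: "\<And>k. 0 \<le> a k"
    and step: "\<And>k. k \<in> {1..N} \<Longrightarrow>
      2 * (2 / (\<gamma> * real k)) * (D k + \<gamma> / 4 * a k - b k / \<gamma>) + a (Suc k) \<le> a k + (2 / (\<gamma> * real k))\<^sup>2 * V k"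
  shows "(\<Sum>k=1..N. D k) \<le> (\<Sum>k=1..N. b k + V k / real k) / \<gamma>"
proof -
  have one: "D k \<le> (b k + V k / real k) / \<gamma> + \<gamma> / 4 * (real (k - 1) * a k - real k * a (Suc k))"
    if k: "k \<in> {1..N}" for k
  proof -
    have k0: "0 < real k" using k by simp
    have "\<gamma> * real k / 4 * (2 * (2 / (\<gamma> * real k)) * (D k + \<gamma> / 4 * a k - b k / \<gamma>) + a (Suc k))
        \<le> \<gamma> * real k / 4 * (a k + (2 / (\<gamma> * real k))\<^sup>2 * V k)"
      using step[OF k] \<gamma> by (intro mult_left_mono) auto
    moreover have "\<gamma> * real k / 4 * (2 * (2 / (\<gamma> * real k)) * (D k + \<gamma> / 4 * a k - b k / \<gamma>) + a (Suc k))
        = (D k + \<gamma> / 4 * a k - b k / \<gamma>) + \<gamma> / 4 * (real k * a (Suc k))"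
      using \<gamma> k0 by (simp add: field_simps)
    moreover have "\<gamma> * real k / 4 * (a k + (2 / (\<gamma> * real k))\<^sup>2 * V k)
        = \<gamma> / 4 * (real k * a k) + V k / real k / \<gamma>"
      using \<gamma> k0 by (simp add: field_simps power2_eq_square)
    moreover have "real (k - 1) = real k - 1" using k by simp
    ultimately show ?thesis by (simp add: add_divide_distrib algebra_simps)
  qed
  have tele: "(\<Sum>k=1..m. real (k - 1) * a k - real k * a (Suc k)) = - (real m * a (Suc m))" for m
    by (induction m) auto
  have "(\<Sum>k=1..N. D k) \<le> (\<Sum>k=1..N. (b k + V k / real k) / \<gamma>
      + \<gamma> / 4 * (real (k - 1) * a k - real k * a (Suc k)))"
    by (rule sum_mono) (rule one)
  also have "\<dots> = (\<Sum>k=1..N. (b k + V k / real k) / \<gamma>)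
      + (\<Sum>k=1..N. \<gamma> / 4 * (real (k - 1) * a k - real k * a (Suc k)))"
    by (rule sum.distrib)
  also have "(\<Sum>k=1..N. \<gamma> / 4 * (real (k - 1) * a k - real k * a (Suc k)))
      = \<gamma> / 4 * (- (real N * a (Suc N)))"
    unfolding sum_distrib_left[symmetric] tele ..
  also have "(\<Sum>k=1..N. (b k + V k / real k) / \<gamma>) = (\<Sum>k=1..N. b k + V k / real k) / \<gamma>"
    by (rule sum_divide_distrib[symmetric])
  also have "(\<Sum>k=1..N. b k + V k / real k) / \<gamma> + \<gamma> / 4 * (- (real N * a (Suc N)))
      \<le> (\<Sum>k=1..N. b k + V k / real k) / \<gamma>"
    using \<gamma> a[of "Suc N"] by simp
  finally show ?thesis .
qed
text \<open>Jensen's inequality for the empirical mean, from the supporting hyperplane at the mean.\<close>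

lemma average_gap_le:
  fixes f :: "'a::real_inner \<Rightarrow> real"
  assumes f: "\<And>y. f z + d \<bullet> (y - z) \<le> f y" and z: "z = (1 / real N) *\<^sub>R (\<Sum>k=1..N. y k)" and N: "1 \<le> N"
  shows "f z \<le> (\<Sum>k=1..N. f (y k)) / real N"
proof -
  have "(\<Sum>k=1..N. y k) = real N *\<^sub>R z" using N z by simp
  then have "(\<Sum>k=1..N. y k - z) = 0" by (simp add: sum_subtractf sum_constant_scaleR)
  then have "(\<Sum>k=1..N. f z + d \<bullet> (y k - z)) = real N * f z"
    by (simp add: sum.distrib inner_sum_right[symmetric])
  moreover have "(\<Sum>k=1..N. f z + d \<bullet> (y k - z)) \<le> (\<Sum>k=1..N. f (y k))"
    by (rule sum_mono) (rule f)
  ultimately show ?thesis using N by (simp add: field_simps)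
qed

section \<open>The convergence rate\<close>

theorem theorem1:
  fixes f :: "real^'n::finite \<Rightarrow> real"
    and Q :: "(real^'n) set"
    and K :: "real \<Rightarrow> real"
    and M :: "'w measure"
    and r :: "nat \<Rightarrow> 'w \<Rightarrow> real"
    and e :: "nat \<Rightarrow> 'w \<Rightarrow> real^'n"
    and \<xi> \<xi>' :: "nat \<Rightarrow> 'w \<Rightarrow> real"
    and x :: "nat \<Rightarrow> 'w \<Rightarrow> real^'n"
    and x1 xstar :: "real^'n"
    and \<alpha> \<tau> :: "nat \<Rightarrow> real"
    and \<beta> \<gamma> L G \<sigma> \<epsilon>0 c cstar \<kappa> \<kappa>\<beta> A1 A2 n :: real
    and N :: nat
  assumes "\<gamma> > 0" "L > 0" "\<beta> > 2" "\<sigma> \<ge> 0" "\<epsilon>0 > 0" "N \<ge> 1"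
    and n: "n = real CARD('n)"
    and Q: "convex Q" "compact Q"
    and f: "f \<in> strongly_convex_holder_class Q \<epsilon>0 \<gamma> \<beta> L"
    and xstar: "is_arg_min f (\<lambda>y. y \<in> Q) xstar"
    and K: "smoothing_kernel \<beta> K" "set_integrable lborel {-1..1} (\<lambda>u. (K u)\<^sup>2)"
    and \<kappa>: "\<kappa> = (LINT u:{-1..1}|lborel. (K u)\<^sup>2)"
    and \<kappa>\<beta>: "\<kappa>\<beta> = (LINT u:{-1..1}|lborel. \<bar>u\<bar> powr \<beta> * \<bar>K u\<bar>)"
    and c: "0 < c" "c < 3"
      "\<And>(h :: real^'n \<Rightarrow> real) H. H-lipschitz_on UNIV h \<Longrightarrow>
         sqrt (LINT v|uniform_sphere. (h v - (LINT w|uniform_sphere. h w)) ^ 4) \<le> c * H\<^sup>2 / n"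
    and cstar: "cstar = 3 * c"
    and \<tau>: "\<And>k. k \<in> {1..N} \<Longrightarrow>
         \<tau> k = (3 * \<kappa> * \<sigma>\<^sup>2 * n / (2 * (\<beta> - 1) * (\<kappa>\<beta> * L)\<^sup>2)) powr (1 / (2 * \<beta>))
                 * real k powr (- 1 / (2 * \<beta>))"
    and \<tau>_pos: "\<And>k. k \<in> {1..N} \<Longrightarrow> \<tau> k > 0"
    and \<tau>_le: "\<tau> 1 \<le> \<epsilon>0"
    and \<alpha>: "\<And>k. k \<in> {1..N} \<Longrightarrow> \<alpha> k = 2 / (\<gamma> * real k)"
    and lipschitz: "G-lipschitz_on (nbhd Q (\<tau> 1)) f"
    and M: "prob_space M"
    and noise: "noise_assumption M N \<sigma> r e \<xi> \<xi>'"
    and draws: "fresh_uniform_draws M N r e \<xi> \<xi>'"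
    and x1: "x1 \<in> Q"
    and algorithm: "\<And>\<omega>. \<omega> \<in> space M \<Longrightarrow>
         zo_spg f Q K \<alpha> \<tau> N x1 (\<lambda>k. r k \<omega>) (\<lambda>k. e k \<omega>) (\<lambda>k. \<xi> k \<omega>) (\<lambda>k. \<xi>' k \<omega>) (\<lambda>k. x k \<omega>)"
    and A1: "A1 = 3 * \<beta> * (\<kappa> * \<sigma>\<^sup>2) powr ((\<beta> - 1) / \<beta>) * (\<kappa>\<beta> * L) powr (2 / \<beta>)"
    and A2: "A2 = cstar * \<kappa> * G\<^sup>2"
  shows "integrable M (\<lambda>\<omega>. f ((1 / real N) *\<^sub>R (\<Sum>k=1..N. x k \<omega>)) - f xstar) \<and>
    (LINT \<omega>|M. f ((1 / real N) *\<^sub>R (\<Sum>k=1..N. x k \<omega>)) - f xstar)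
      \<le> 1 / \<gamma> * (n powr (2 - 1 / \<beta>) * (A1 / real N powr ((\<beta> - 1) / \<beta>))
                   + A2 * (n * (1 + ln (real N)) / real N))"
proof -
  interpret prob_space M by fact
  define B where "B = 3 * \<kappa> * \<sigma>\<^sup>2 * n / (2 * (\<beta> - 1) * (\<kappa>\<beta> * L)\<^sup>2)"
  have n0: "0 < n" unfolding n by simp
  have cont: "continuous_on UNIV f" by (rule continuous_on_strongly_convex_holder_class[OF f \<open>\<beta> > 2\<close>])
  have fm[measurable]: "f \<in> borel_measurable borel" by (rule borel_measurable_continuous_onI[OF cont])
  have Km: "K \<in> borel_measurable borel" by (rule smoothing_kernel_measurable[OF K(1)])
  have xstarQ: "xstar \<in> Q" using xstar by (simp add: is_arg_min_def)
  have \<kappa>0: "0 \<le> \<kappa>" unfolding \<kappa> set_lebesgue_integral_def by (rule integral_nonneg_AE) simp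
  have \<kappa>\<beta>0: "0 \<le> \<kappa>\<beta>" unfolding \<kappa>\<beta> set_lebesgue_integral_def by (rule integral_nonneg_AE) simp

  \<comment> \<open>A positive step radius forces the noise level and both kernel constants to be positive.\<close>
  have B0: "0 < B"
  proof -
    have "0 \<le> B" unfolding B_def using \<kappa>0 n0 \<open>\<beta> > 2\<close> by simp
    moreover have "B \<noteq> 0" using \<tau>_pos[of 1] \<tau>[of 1] \<open>N \<ge> 1\<close> unfolding B_def[symmetric] by auto
    ultimately show ?thesis by simp
  qed
  have W0: "0 < \<kappa>\<beta> * L"
    using B0 \<kappa>\<beta>0 \<open>L > 0\<close> by (cases "\<kappa>\<beta> = 0") (auto simp: B_def)
  have \<kappa>\<sigma>: "0 < \<kappa> * \<sigma>\<^sup>2"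
    using B0 \<kappa>0 by (cases "\<kappa> * \<sigma>\<^sup>2 = 0") (auto simp: B_def less_le)

  define D where "D k = (LINT \<omega>|M. f (x k \<omega>) - f xstar)" for k
  define a where "a k = (LINT \<omega>|M. (norm (x k \<omega> - xstar))\<^sup>2)" for k
  define b where "b k = (\<kappa>\<beta> / 2 * L * sqrt n * \<tau> k powr (\<beta> - 1))\<^sup>2" for k
  define V where "V k = \<kappa> / 2 * (3 * c * n * G\<^sup>2 + 6 * (n / (2 * \<tau> k))\<^sup>2 * \<sigma>\<^sup>2)" for k
  have xQ: "x k \<omega> \<in> Q" if "k \<in> {1..N}" "\<omega> \<in> space M" for k \<omega>
    using iterate_in_set[OF algorithm[OF that(2)] Q(2) x1, of k] that(1) by simp
  have indep: "indep_rvs M (borel \<Otimes>\<^sub>M borel) (\<lambda>\<omega>. (x k \<omega>, (\<xi> k \<omega>, \<xi>' k \<omega>))) borel (\<lambda>\<omega>. (e k \<omega>, r k \<omega>))"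
    if "k \<in> {1..N}" for k
    by (rule iterate_independent_of_draw[OF M draws algorithm fm Km Q x1 that])
  have xm: "x k \<in> borel_measurable M" if "k \<in> {1..N}" for k
  proof -
    have "(\<lambda>\<omega>. (x k \<omega>, (\<xi> k \<omega>, \<xi>' k \<omega>))) \<in> measurable M (borel \<Otimes>\<^sub>M borel)"
      using indep[OF that] by (simp add: indep_rvs_def)
    from measurable_compose[OF this measurable_fst] show ?thesis by simp
  qed

  have "2 * (2 / (\<gamma> * real k)) * (D k + \<gamma> / 4 * a k - b k / \<gamma>) + a (Suc k)
      \<le> a k + (2 / (\<gamma> * real k))\<^sup>2 * V k" if k: "k \<in> {1..N}" for k
  proof -
    have \<tau>k: "\<tau> k \<le> \<tau> 1"
    proof -
      have le: "real k powr (- 1 / (2 * \<beta>)) \<le> 1 powr (- 1 / (2 * \<beta>))"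
        using k \<open>\<beta> > 2\<close> by (intro powr_mono2') auto
      then show ?thesis
        using mult_left_mono[OF le, of "B powr (1 / (2 * \<beta>))"] \<tau>[OF k] \<tau>[of 1] \<open>N \<ge> 1\<close>
        unfolding B_def by simp
    qed
    have lip: "G-lipschitz_on (nbhd Q (\<tau> k)) f"
      using \<tau>k by (intro lipschitz_on_subset[OF lipschitz]) (auto simp: nbhd_def)
    have \<alpha>k: "0 < \<alpha> k" using \<alpha>[OF k] \<open>\<gamma> > 0\<close> k by simp
    have noise_k: "integrable M (\<lambda>\<omega>. (\<xi> k \<omega>)\<^sup>2)" "(LINT \<omega>|M. (\<xi> k \<omega>)\<^sup>2) \<le> \<sigma>\<^sup>2"
      "integrable M (\<lambda>\<omega>. (\<xi>' k \<omega>)\<^sup>2)" "(LINT \<omega>|M. (\<xi>' k \<omega>)\<^sup>2) \<le> \<sigma>\<^sup>2"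
      using noise k by (auto simp: noise_assumption_def)
    have step: "x (Suc k) \<omega> = closest_point Q
        (x k \<omega> - \<alpha> k *\<^sub>R grad_estimate f K (\<tau> k) (r k \<omega>) (e k \<omega>) (\<xi> k \<omega>) (\<xi>' k \<omega>) (x k \<omega>))"
      if "\<omega> \<in> space M" for \<omega>
      using algorithm[OF that] k unfolding zo_spg_def by blast
    have "\<tau> k \<le> \<epsilon>0" using \<tau>k \<tau>_le by simp
    then show ?thesis
      using expected_step[OF M indep[OF k] distr_draw[OF M draws noise k] noise_k Q xQ[OF k] xstarQ f
          \<open>\<gamma> > 0\<close> less_imp_le[OF \<open>L > 0\<close>] \<open>\<beta> > 2\<close> K \<tau>_pos[OF k] _ lip less_imp_le[OF c(1)]
          c(3)[unfolded n] \<alpha>k step]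
      unfolding \<alpha>[OF k] D_def a_def b_def V_def n \<kappa> \<kappa>\<beta> by simp
  qed
  then have total: "(\<Sum>k=1..N. D k) \<le> (\<Sum>k=1..N. b k + V k / real k) / \<gamma>"
    by (rule telescoped_recursion[OF \<open>\<gamma> > 0\<close>, rotated]) (simp_all add: a_def)

  let ?C = "3 / 4 * (1 + 1 / (2 * (\<beta> - 1))) * \<kappa> * \<sigma>\<^sup>2 * n\<^sup>2 * B powr (- 1 / \<beta>)"
  let ?C' = "3 * c * \<kappa> * G\<^sup>2 / 2 * n"
  have "(\<Sum>k=1..N. b k + V k / real k)
      = (\<Sum>k=1..N. ?C * real k powr (1 / \<beta> - 1) + ?C' * (1 / real k))"
    unfolding b_def V_def
    by (intro sum.cong refl balanced_step_cost[OF \<open>\<beta> > 2\<close> n0 W0 _ B_def B0]) (auto simp: \<tau> B_def)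
  also have "\<dots> = ?C * (\<Sum>k=1..N. real k powr (1 / \<beta> - 1)) + ?C' * (\<Sum>k=1..N. 1 / real k)"
    by (simp only: sum.distrib sum_distrib_left)
  finally have costs: "(\<Sum>k=1..N. b k + V k / real k) / real N
      = ?C * (\<Sum>k=1..N. real k powr (1 / \<beta> - 1)) / real N + ?C' * (\<Sum>k=1..N. 1 / real k) / real N"
    by (simp only: add_divide_distrib)
  have "?C' * (\<Sum>k=1..N. 1 / real k) / real N \<le> A2 * (n * (1 + ln (real N)) / real N)"
  proof -
    have C'0: "0 \<le> ?C'" using c(1) \<kappa>0 n0 by simp
    \<comment> \<open>\<open>A2\<close> is defined with the integral of \<open>K\<^sup>2\<close> over \<open>[-1, 1]\<close>, which is twice the expectation that
      enters the step cost; hence the factor \<open>2\<close>.\<close>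
    have "?C' * (\<Sum>k=1..N. 1 / real k) \<le> (2 * ?C') * (1 + ln (real N))"
    proof (rule mult_mono)
      show "?C' \<le> 2 * ?C'" "0 \<le> 2 * ?C'" using C'0 by linarith+
    qed (use sum_inverse_le[OF \<open>N \<ge> 1\<close>] in \<open>auto intro: sum_nonneg\<close>)
    then have "?C' * (\<Sum>k=1..N. 1 / real k) / real N \<le> (2 * ?C') * (1 + ln (real N)) / real N"
      by (rule divide_right_mono) simp
    then show ?thesis unfolding A2 cstar by (simp add: mult_ac)
  qed
  with balanced_rate[OF \<open>\<beta> > 2\<close> n0 W0 \<kappa>\<sigma> \<open>N \<ge> 1\<close> B_def]
  have rate: "(\<Sum>k=1..N. b k + V k / real k) / real N
      \<le> n powr (2 - 1 / \<beta>) * (A1 / real N powr ((\<beta> - 1) / \<beta>)) + A2 * (n * (1 + ln (real N)) / real N)"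
    unfolding costs A1 by (rule add_mono)

  let ?avg = "\<lambda>\<omega>. (1 / real N) *\<^sub>R (\<Sum>k=1..N. x k \<omega>)"
  have avgQ: "?avg \<omega> \<in> Q" if "\<omega> \<in> space M" for \<omega>
  proof -
    have "(\<Sum>k=1..N. (1 / real N) *\<^sub>R x k \<omega>) \<in> Q"
      using Q(1) \<open>N \<ge> 1\<close> xQ[OF _ that] by (intro convex_sum) auto
    then show ?thesis by (simp add: scaleR_sum_right)
  qed
  have avgm: "?avg \<in> borel_measurable M"
    using xm by (intro borel_measurable_scaleR borel_measurable_sum) auto
  obtain C where C: "\<And>y. y \<in> Q \<Longrightarrow> \<bar>f y - f xstar\<bar> \<le> C"
  proof -
    have "compact ((\<lambda>y. f y - f xstar) ` Q)"
      using Q(2) by (intro compact_continuous_image continuous_intros continuous_on_subset[OF cont]) auto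
    then obtain C where "\<forall>z\<in>(\<lambda>y. f y - f xstar) ` Q. norm z \<le> C"
      using compact_imp_bounded bounded_iff by metis
    then show ?thesis using that[of C] by auto
  qed
  have gap_int: "integrable M (\<lambda>\<omega>. f (y \<omega>) - f xstar)"
    if "y \<in> borel_measurable M" "\<And>\<omega>. \<omega> \<in> space M \<Longrightarrow> y \<omega> \<in> Q" for y
  proof (rule integrable_const_bound[of _ C])
    show "AE \<omega> in M. norm (f (y \<omega>) - f xstar) \<le> C" using C that(2) by (intro AE_I2) simp
    show "(\<lambda>\<omega>. f (y \<omega>) - f xstar) \<in> borel_measurable M"
      using that(1) by measurable
  qed
  have int_k: "integrable M (\<lambda>\<omega>. f (x k \<omega>) - f xstar)" if "k \<in> {1..N}" for k
    using gap_int[OF xm[OF that]] xQ[OF that] by blast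
  have int_avg: "integrable M (\<lambda>\<omega>. f (?avg \<omega>) - f xstar)"
    by (rule gap_int[OF avgm avgQ])
  have "(LINT \<omega>|M. f (?avg \<omega>) - f xstar) \<le> (LINT \<omega>|M. (\<Sum>k=1..N. f (x k \<omega>) - f xstar) / real N)"
  proof (rule integral_mono[OF int_avg])
    show "integrable M (\<lambda>\<omega>. (\<Sum>k=1..N. f (x k \<omega>) - f xstar) / real N)"
      using int_k by (intro integrable_divide_zero Bochner_Integration.integrable_sum) auto
    fix \<omega> assume "\<omega> \<in> space M"
    have "f (?avg \<omega>) + grad f (?avg \<omega>) \<bullet> (y - ?avg \<omega>) \<le> f y" for y
    proof -
      have "0 \<le> \<gamma> / 2 * (norm (?avg \<omega> - y))\<^sup>2" using \<open>\<gamma> > 0\<close> by simp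
      moreover have "f (?avg \<omega>) + grad f (?avg \<omega>) \<bullet> (y - ?avg \<omega>) + \<gamma> / 2 * (norm (?avg \<omega> - y))\<^sup>2 \<le> f y"
        using f unfolding strongly_convex_holder_class_def by blast
      ultimately show ?thesis by linarith
    qed
    from average_gap_le[OF this refl \<open>N \<ge> 1\<close>]
    show "f (?avg \<omega>) - f xstar \<le> (\<Sum>k=1..N. f (x k \<omega>) - f xstar) / real N"
      using \<open>N \<ge> 1\<close> by (simp add: sum_subtractf diff_divide_distrib)
  qed
  also have "\<dots> = (\<Sum>k=1..N. D k) / real N"
    unfolding D_def using int_k by (simp add: Bochner_Integration.integral_sum)
  also have "\<dots> \<le> (\<Sum>k=1..N. b k + V k / real k) / \<gamma> / real N"
    using total by (rule divide_right_mono) simp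
  also have "\<dots> = 1 / \<gamma> * ((\<Sum>k=1..N. b k + V k / real k) / real N)" by simp
  also have "\<dots> \<le> 1 / \<gamma> * (n powr (2 - 1 / \<beta>) * (A1 / real N powr ((\<beta> - 1) / \<beta>))
      + A2 * (n * (1 + ln (real N)) / real N))"
    using rate \<open>\<gamma> > 0\<close> by (intro mult_left_mono) auto
  finally show ?thesis using int_avg by blast
qed

end
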